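(* Every analytic measure $\mu$ on $\mathbb{T}^\infty$, that is, every finite complex Borel measure $\mu$ on $\mathbb{T}^\infty$ with $\widehat\mu(\nu)=0$ for all $\nu\in\mathbb{Z}^\infty_0\setminus\mathbb{N}^\infty_0$, is absolutely continuous with respect to the Haar measure of $\mathbb{T}^\infty$.
   Context: $\mathbb{T}$ is the unit circle and $\mathbb{T}^\infty=\{(z_1,z_2,\ldots):z_n\in\mathbb{T}\}$ is the compact abelian group (product topology) with normalized Haar measure $d\theta=d\theta_1\times d\theta_2\times\cdots$. $\mathbb{Z}^\infty_0$ is the set of integer sequences $\nu=(\nu_1,\nu_2,\ldots)$ with only finitely many non-zero entries, and $\mathbb{N}^\infty_0$ is the subset of those with all entries $\ge0$. The Fourier coefficients of $\mu$ are $\widehat\mu(\nu)=\int_{\mathbb{T}^\infty}e^{-i\nu\cdot\theta}\,d\mu$, $\nu\cdot\theta=\sum_j\nu_j\theta_j$. *)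

theory Defs
  imports "HOL-Probability.Probability"
begin

section \<open>Countably additive set functions and their integrals\<close>

text \<open>
  For \<^typ>\<open>'b\<close> = \<^typ>\<open>real\<close> this is a finite signed measure, for \<^typ>\<open>'b\<close> = \<^typ>\<open>complex\<close> a finite
  complex measure, on the sigma-algebra \<open>sets M\<close>. Only this sigma-algebra is relevant, not the
  positive measure carried by \<open>M\<close>; values of \<open>\<mu>\<close> off \<open>sets M\<close> are arbitrary.
  The equation \<open>\<mu> {} = 0\<close> follows by taking every \<open>A n\<close> empty.
\<close>

definition vector_measure :: "'a measure \<Rightarrow> ('a set \<Rightarrow> 'b::real_normed_vector) \<Rightarrow> bool" where
  "vector_measure M \<mu> \<longleftrightarrow>
     (\<forall>A :: nat \<Rightarrow> 'a set. range A \<subseteq> sets M \<longrightarrow> disjoint_family A \<longrightarrow>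
        (\<lambda>n. \<mu> (A n)) sums \<mu> (\<Union>n. A n))"

text \<open>
  The positive part of the Jordan decomposition of a signed measure. Subsets on which \<open>\<rho>\<close> is
  negative do not contribute to the supremum, since \<open>{}\<close> competes and \<open>ennreal\<close> truncates at 0.
\<close>

definition positive_part :: "'a measure \<Rightarrow> ('a set \<Rightarrow> real) \<Rightarrow> 'a measure" where
  "positive_part M \<rho> =
     measure_of (space M) (sets M) (\<lambda>A. SUP B\<in>{B \<in> sets M. B \<subseteq> A}. ennreal (\<rho> B))"

definition signed_integral :: "'a measure \<Rightarrow> ('a set \<Rightarrow> real) \<Rightarrow> ('a \<Rightarrow> complex) \<Rightarrow> complex" where
  "signed_integral M \<rho> f =
     (\<integral>x. f x \<partial>positive_part M \<rho>) - (\<integral>x. f x \<partial>positive_part M (\<lambda>A. - \<rho> A))"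

definition complex_measure_integral ::
    "'a measure \<Rightarrow> ('a set \<Rightarrow> complex) \<Rightarrow> ('a \<Rightarrow> complex) \<Rightarrow> complex" where
  "complex_measure_integral M \<mu> f =
     signed_integral M (\<lambda>A. Re (\<mu> A)) f + \<i> * signed_integral M (\<lambda>A. Im (\<mu> A)) f"


text \<open>
  The next lemmas show that the supremum in \<open>positive_part\<close> really is a finite measure (otherwise
  \<open>measure_of\<close> would return the null measure), that it yields the Jordan decomposition, and that
  the integral of an indicator function is the measure of the set.
\<close>

lemma sets_positive_part [simp, measurable_cong]: "sets (positive_part M \<rho>) = sets M"
  and space_positive_part [simp]: "space (positive_part M \<rho>) = space M"
  by (simp_all add: positive_part_def)

lemma vector_measure_sums:
  "vector_measure M \<mu> \<Longrightarrow> range A \<subseteq> sets M \<Longrightarrow> disjoint_family A \<Longrightarrow>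
     (\<lambda>n. \<mu> (A n)) sums \<mu> (\<Union>n. A n)"
  unfolding vector_measure_def by blast

lemma vector_measure_empty:
  assumes "vector_measure M \<mu>"
  shows "\<mu> {} = 0"
proof -
  have "(\<lambda>n::nat. \<mu> {}) sums \<mu> (\<Union>n::nat. {})"
    by (rule vector_measure_sums[OF assms]) (auto simp: disjoint_family_on_def)
  then have "(\<lambda>n::nat. \<mu> {}) \<longlonglongrightarrow> 0"
    by (intro summable_LIMSEQ_zero) (auto simp: summable_def)
  then show ?thesis
    by (simp add: LIMSEQ_const_iff)
qed

lemma vector_measure_Un:
  assumes \<mu>: "vector_measure M \<mu>" and A: "A \<in> sets M" "B \<in> sets M" "A \<inter> B = {}"
  shows "\<mu> (A \<union> B) = \<mu> A + \<mu> B"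
proof -
  have "(\<lambda>n. \<mu> (binaryset A B n)) sums \<mu> (\<Union>n. binaryset A B n)"
    using A by (intro vector_measure_sums[OF \<mu>])
      (auto simp: range_binaryset_eq disjoint_family_on_def binaryset_def)
  moreover have "(\<lambda>n. \<mu> (binaryset A B n)) sums (\<mu> A + \<mu> B)"
    by (rule binaryset_sums) (rule vector_measure_empty[OF \<mu>])
  ultimately show ?thesis
    by (simp add: UN_binaryset_eq sums_unique2)
qed

lemma vector_measure_Diff:
  assumes \<mu>: "vector_measure M \<mu>" and A: "A \<in> sets M" "B \<in> sets M" "B \<subseteq> A"
  shows "\<mu> (A - B) = \<mu> A - \<mu> B"
proof -
  have "\<mu> ((A - B) \<union> B) = \<mu> (A - B) + \<mu> B"
    using A by (intro vector_measure_Un[OF \<mu>]) auto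
  moreover have "(A - B) \<union> B = A"
    using A by blast
  ultimately show ?thesis
    by simp
qed

lemma vector_measure_uminus:
  "vector_measure M \<mu> \<Longrightarrow> vector_measure M (\<lambda>A. - \<mu> A)"
  unfolding vector_measure_def by (simp add: sums_minus)

lemma vector_measure_Re: "vector_measure M \<mu> \<Longrightarrow> vector_measure M (\<lambda>A. Re (\<mu> A))"
  and vector_measure_Im: "vector_measure M \<mu> \<Longrightarrow> vector_measure M (\<lambda>A. Im (\<mu> A))"
  by (simp_all add: vector_measure_def sums_complex_iff)

lemma signed_measure_bounded:
  fixes \<rho> :: "'a set \<Rightarrow> real"
  assumes \<rho>: "vector_measure M \<rho>"
  obtains K where "\<And>B. B \<in> sets M \<Longrightarrow> \<bar>\<rho> B\<bar> \<le> K"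
proof -
  define bad where
    "bad A \<longleftrightarrow> A \<in> sets M \<and> (\<forall>K. \<exists>B\<in>sets M. B \<subseteq> A \<and> \<bar>\<rho> B\<bar> > K)" for A
  have step: "\<exists>A'. bad A' \<and> A' \<subseteq> A \<and> \<bar>\<rho> (A - A')\<bar> \<ge> 1" if "bad A" for A
  proof -
    have A: "A \<in> sets M"
      using that by (simp add: bad_def)
    obtain B where B: "B \<in> sets M" "B \<subseteq> A" "\<bar>\<rho> B\<bar> > \<bar>\<rho> A\<bar> + 1"
      using \<open>bad A\<close>[unfolded bad_def, THEN conjunct2, THEN spec, of "\<bar>\<rho> A\<bar> + 1"] by auto
    have d: "\<rho> (A - B) = \<rho> A - \<rho> B"
      by (rule vector_measure_Diff[OF \<rho> A B(1,2)])
    have "bad B \<or> bad (A - B)"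
    proof (rule ccontr)
      assume "\<not> (bad B \<or> bad (A - B))"
      then obtain K L where "\<forall>C\<in>sets M. C \<subseteq> B \<longrightarrow> \<bar>\<rho> C\<bar> \<le> K"
        and "\<forall>C\<in>sets M. C \<subseteq> A - B \<longrightarrow> \<bar>\<rho> C\<bar> \<le> L"
        using A B(1) by (auto simp: bad_def not_less)
      then have K: "\<And>C. C \<in> sets M \<Longrightarrow> C \<subseteq> B \<Longrightarrow> \<bar>\<rho> C\<bar> \<le> K"
        and L: "\<And>C. C \<in> sets M \<Longrightarrow> C \<subseteq> A - B \<Longrightarrow> \<bar>\<rho> C\<bar> \<le> L"
        by auto
      have "\<bar>\<rho> C\<bar> \<le> K + L" if C: "C \<in> sets M" "C \<subseteq> A" for C
      proof -
        have "\<rho> ((C \<inter> B) \<union> (C - B)) = \<rho> (C \<inter> B) + \<rho> (C - B)"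
          using C B by (intro vector_measure_Un[OF \<rho>]) auto
        moreover have "(C \<inter> B) \<union> (C - B) = C"
          by blast
        moreover have "\<bar>\<rho> (C \<inter> B)\<bar> \<le> K" "\<bar>\<rho> (C - B)\<bar> \<le> L"
          using C B by (auto intro!: K L)
        ultimately show ?thesis
          by simp
      qed
      then show False
        using \<open>bad A\<close>[unfolded bad_def, THEN conjunct2, THEN spec, of "K + L"]
        by (auto simp: not_le[symmetric])
    qed
    then show ?thesis
    proof
      assume "bad B"
      moreover have "1 \<le> \<bar>\<rho> (A - B)\<bar>"
        using B(3) d by linarith
      ultimately show ?thesis
        using B(2) by blast
    next
      assume "bad (A - B)"
      moreover have "A - (A - B) = B"
        using B by blast
      moreover have "1 \<le> \<bar>\<rho> B\<bar>"
        using B(3) by linarith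
      ultimately show ?thesis
        by (intro exI[of _ "A - B"]) auto
    qed
  qed
  have "\<not> bad (space M)"
  proof
    assume "bad (space M)"
    then have "\<exists>S :: nat \<Rightarrow> 'a set. \<forall>n. bad (S n) \<and>
        (S (Suc n) \<subseteq> S n \<and> \<bar>\<rho> (S n - S (Suc n))\<bar> \<ge> 1)"
      by (intro dependent_nat_choice) (use step in blast)+
    then obtain S :: "nat \<Rightarrow> 'a set" where S: "\<And>n. bad (S n)"
      "\<And>n. S (Suc n) \<subseteq> S n \<and> \<bar>\<rho> (S n - S (Suc n))\<bar> \<ge> 1"
      by blast
    have dec: "S n \<subseteq> S m" if "m \<le> n" for m n
      using that S(2) by (metis lift_Suc_antimono_le)
    have "disjoint_family (\<lambda>n. S n - S (Suc n))"
      unfolding disjoint_family_on_def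
    proof (intro ballI impI)
      fix m n :: nat
      assume "m \<noteq> n"
      then have "S n \<subseteq> S (Suc m) \<or> S m \<subseteq> S (Suc n)"
        using dec[of "Suc m" n] dec[of "Suc n" m] by linarith
      then show "(S m - S (Suc m)) \<inter> (S n - S (Suc n)) = {}"
        by blast
    qed
    moreover have "range (\<lambda>n. S n - S (Suc n)) \<subseteq> sets M"
      using S(1) unfolding bad_def by auto
    ultimately have "summable (\<lambda>n. \<rho> (S n - S (Suc n)))"
      using vector_measure_sums[OF \<rho>] by (blast intro: sums_summable)
    then have "(\<lambda>n. \<bar>\<rho> (S n - S (Suc n))\<bar>) \<longlonglongrightarrow> 0"
      by (intro tendsto_rabs_zero summable_LIMSEQ_zero)
    then have "1 \<le> (0::real)"
      by (rule LIMSEQ_le_const) (use S(2) in blast)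
    then show False
      by simp
  qed
  then obtain K where "\<forall>B\<in>sets M. B \<subseteq> space M \<longrightarrow> \<bar>\<rho> B\<bar> \<le> K"
    by (auto simp: bad_def not_less)
  then show thesis
    using that[of K] sets.sets_into_space[of _ M] by auto
qed

lemma emeasure_positive_part:
  fixes \<rho> :: "'a set \<Rightarrow> real"
  assumes \<rho>: "vector_measure M \<rho>" and A: "A \<in> sets M"
  shows "emeasure (positive_part M \<rho>) A = (SUP B\<in>{B \<in> sets M. B \<subseteq> A}. ennreal (\<rho> B))"
proof -
  define V where "V A = (SUP B\<in>{B \<in> sets M. B \<subseteq> A}. ennreal (\<rho> B))" for A
  have V_upper: "ennreal (\<rho> B) \<le> V A" if "B \<in> sets M" "B \<subseteq> A" for A B
    unfolding V_def using that by (intro SUP_upper) auto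
  have V_mono: "V A \<le> V B" if "A \<subseteq> B" for A B
    unfolding V_def using that by (intro SUP_subset_mono) auto
  have V_empty: "V {} = 0"
  proof -
    have "{B \<in> sets M. B \<subseteq> {}} = {{}}"
      by auto
    then show ?thesis
      by (simp add: V_def vector_measure_empty[OF \<rho>])
  qed
  have V_Un: "V A + V B \<le> V (A \<union> B)" if "A \<in> sets M" "B \<in> sets M" "A \<inter> B = {}" for A B
  proof -
    have le: "ennreal (\<rho> C) + ennreal (\<rho> D) \<le> V (A \<union> B)"
      if "C \<in> sets M" "C \<subseteq> A" "D \<in> sets M" "D \<subseteq> B" for C D
    proof (cases "\<rho> C \<ge> 0 \<and> \<rho> D \<ge> 0")
      case True
      have "\<rho> (C \<union> D) = \<rho> C + \<rho> D"
        using that \<open>A \<inter> B = {}\<close> by (intro vector_measure_Un[OF \<rho>]) auto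
      then show ?thesis
        using V_upper[of "C \<union> D" "A \<union> B"] that True by (auto simp: ennreal_plus)
    next
      case False
      then show ?thesis
        using V_upper[of C "A \<union> B"] V_upper[of D "A \<union> B"] that
        by (auto simp: ennreal_neg not_le le_supI1 le_supI2)
    qed
    have ne: "{C \<in> sets M. C \<subseteq> X} \<noteq> {}" for X
      by auto
    have "V A + V B = (SUP C\<in>{C \<in> sets M. C \<subseteq> A}. ennreal (\<rho> C) + V B)"
      unfolding V_def[of A] by (rule ennreal_SUP_add_left[OF ne, symmetric])
    also have "\<dots> = (SUP C\<in>{C \<in> sets M. C \<subseteq> A}. SUP D\<in>{D \<in> sets M. D \<subseteq> B}.
        ennreal (\<rho> C) + ennreal (\<rho> D))"
      unfolding V_def[of B] by (intro SUP_cong refl ennreal_SUP_add_right[OF ne])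
    also have "\<dots> \<le> V (A \<union> B)"
      by (intro SUP_least) (auto intro: le)
    finally show ?thesis .
  qed
  have "countably_additive (sets M) V"
    unfolding countably_additive_def
  proof (intro allI impI)
    fix S :: "nat \<Rightarrow> 'a set"
    assume S: "range S \<subseteq> sets M" "disjoint_family S"
    have V_sum: "(\<Sum>i<n. V (S i)) \<le> V (\<Union>i<n. S i)" for n
    proof (induction n)
      case (Suc n)
      have "S i \<inter> S n = {}" if "i < n" for i
        using S(2) that unfolding disjoint_family_on_def by (metis UNIV_I less_irrefl)
      then have "(\<Union>i<n. S i) \<inter> S n = {}"
        by blast
      then have "V (\<Union>i<n. S i) + V (S n) \<le> V ((\<Union>i<n. S i) \<union> S n)"
        using S(1) by (intro V_Un) auto
      also have "(\<Union>i<n. S i) \<union> S n = (\<Union>i<Suc n. S i)"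
        by (auto simp: lessThan_Suc)
      finally show ?case
        using Suc by (auto intro: order_trans add_right_mono)
    qed (simp add: V_empty)
    have 1: "(\<Sum>i. V (S i)) \<le> V (\<Union>i. S i)"
      by (rule suminf_le_const) (auto intro!: order_trans[OF V_sum] V_mono)
    have 2: "V (\<Union>i. S i) \<le> (\<Sum>i. V (S i))"
      unfolding V_def[of "\<Union>i. S i"]
    proof (rule SUP_least)
      fix B
      assume "B \<in> {B \<in> sets M. B \<subseteq> (\<Union>i. S i)}"
      then have B: "B \<in> sets M" "B \<subseteq> (\<Union>i. S i)"
        by auto
      have "(\<lambda>n. \<rho> (B \<inter> S n)) sums \<rho> (\<Union>n. B \<inter> S n)"
        using S B by (intro vector_measure_sums[OF \<rho>]) (auto simp: disjoint_family_on_def)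
      moreover have "(\<Union>n. B \<inter> S n) = B"
        using B by blast
      ultimately have "(\<lambda>n. \<Sum>i<n. \<rho> (B \<inter> S i)) \<longlonglongrightarrow> \<rho> B"
        by (simp add: sums_def)
      then have lim: "(\<lambda>n. ennreal (\<Sum>i<n. \<rho> (B \<inter> S i))) \<longlonglongrightarrow> ennreal (\<rho> B)"
        by (rule tendsto_ennrealI)
      have bd: "ennreal (\<Sum>i<n. \<rho> (B \<inter> S i)) \<le> (\<Sum>i. V (S i))" for n
      proof -
        have "ennreal (\<Sum>i<n. \<rho> (B \<inter> S i)) \<le> ennreal (\<Sum>i<n. max 0 (\<rho> (B \<inter> S i)))"
          by (intro ennreal_leI sum_mono) auto
        also have "\<dots> = (\<Sum>i<n. ennreal (\<rho> (B \<inter> S i)))"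
          by (subst sum_ennreal[symmetric]) auto
        also have "\<dots> \<le> (\<Sum>i<n. V (S i))"
          using S B by (intro sum_mono V_upper) auto
        also have "\<dots> \<le> (\<Sum>i. V (S i))"
          by (intro sum_le_suminf) auto
        finally show ?thesis .
      qed
      show "ennreal (\<rho> B) \<le> (\<Sum>i. V (S i))"
        by (rule LIMSEQ_le_const2[OF lim]) (use bd in blast)
    qed
    show "(\<Sum>i. V (S i)) = V (\<Union>i. S i)"
      using 1 2 by (rule antisym)
  qed
  moreover have "positive (sets M) V"
    by (simp add: positive_def V_empty)
  ultimately have "emeasure (positive_part M \<rho>) A = V A"
    using A unfolding positive_part_def V_def
    by (intro emeasure_measure_of_sigma sets.sigma_algebra_axioms)
  then show ?thesis
    by (simp add: V_def)
qed

lemma finite_measure_positive_part: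
  fixes \<rho> :: "'a set \<Rightarrow> real"
  assumes \<rho>: "vector_measure M \<rho>"
  shows "finite_measure (positive_part M \<rho>)"
proof
  obtain K where K: "\<And>B. B \<in> sets M \<Longrightarrow> \<bar>\<rho> B\<bar> \<le> K"
    using signed_measure_bounded[OF \<rho>] by blast
  have "emeasure (positive_part M \<rho>) (space M) \<le> ennreal K"
    unfolding emeasure_positive_part[OF \<rho> sets.top]
    by (intro SUP_least ennreal_leI) (use K abs_le_D1 in blast)
  also have "\<dots> < top"
    by simp
  finally show "emeasure (positive_part M \<rho>) (space (positive_part M \<rho>)) \<noteq> \<infinity>"
    by simp
qed

theorem jordan_decomposition:
  fixes \<rho> :: "'a set \<Rightarrow> real"
  assumes \<rho>: "vector_measure M \<rho>" and A: "A \<in> sets M"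
  shows "\<rho> A = measure (positive_part M \<rho>) A - measure (positive_part M (\<lambda>A. - \<rho> A)) A"
proof -
  have half: "\<rho> A + measure (positive_part M (\<lambda>A. - \<rho> A)) A \<le> measure (positive_part M \<rho>) A"
    if \<rho>: "vector_measure M \<rho>" for \<rho> :: "'a set \<Rightarrow> real"
  proof -
    note P = finite_measure.emeasure_eq_measure[OF finite_measure_positive_part[OF \<rho>]]
    note N = finite_measure.emeasure_eq_measure
      [OF finite_measure_positive_part[OF vector_measure_uminus[OF \<rho>]]]
    have upper: "\<rho> B \<le> measure (positive_part M \<rho>) A" if "B \<in> sets M" "B \<subseteq> A" for B
    proof -
      have "ennreal (\<rho> B) \<le> emeasure (positive_part M \<rho>) A"
        unfolding emeasure_positive_part[OF \<rho> A] using that by (intro SUP_upper) auto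
      then show ?thesis
        unfolding P by (subst (asm) ennreal_le_iff) auto
    qed
    have "emeasure (positive_part M (\<lambda>A. - \<rho> A)) A
        \<le> ennreal (measure (positive_part M \<rho>) A - \<rho> A)"
      unfolding emeasure_positive_part[OF vector_measure_uminus[OF \<rho>] A]
    proof (intro SUP_least ennreal_leI)
      fix B
      assume "B \<in> {B \<in> sets M. B \<subseteq> A}"
      then show "- \<rho> B \<le> measure (positive_part M \<rho>) A - \<rho> A"
        using upper[of "A - B"] A vector_measure_Diff[OF \<rho> A, of B] by auto
    qed
    moreover have "0 \<le> measure (positive_part M \<rho>) A - \<rho> A"
      using upper[OF A] by simp
    ultimately show ?thesis
      unfolding N by (subst (asm) ennreal_le_iff) auto
  qed
  show ?thesis
    using half[OF \<rho>] half[OF vector_measure_uminus[OF \<rho>]] by simp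
qed

lemma signed_integral_indicator:
  fixes \<rho> :: "'a set \<Rightarrow> real"
  assumes \<rho>: "vector_measure M \<rho>" and A: "A \<in> sets M"
  shows "signed_integral M \<rho> (indicator A) = of_real (\<rho> A)"
proof -
  have "(\<integral>x. indicator A x \<partial>N) = (of_real (measure N A) :: complex)"
    if "sets N = sets M" "finite_measure N" for N
  proof -
    have "A \<inter> space N = A"
      using A that by (metis sets.Int_space_eq2)
    then have "(\<integral>x. complex_of_real (indicator A x) \<partial>N) = of_real (measure N A)"
      by simp
    then show ?thesis
      by (simp add: of_real_indicator)
  qed
  then show ?thesis
    unfolding signed_integral_def
    by (simp add: finite_measure_positive_part \<rho> vector_measure_uminus
        jordan_decomposition[OF \<rho> A])
qed

theorem complex_measure_integral_indicator:
  fixes \<mu> :: "'a set \<Rightarrow> complex"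
  assumes \<mu>: "vector_measure M \<mu>" and A: "A \<in> sets M"
  shows "complex_measure_integral M \<mu> (indicator A) = \<mu> A"
  unfolding complex_measure_integral_def
  using signed_integral_indicator[OF vector_measure_Re[OF \<mu>] A]
    signed_integral_indicator[OF vector_measure_Im[OF \<mu>] A]
  by (simp add: complex_eq[symmetric])


section \<open>The infinite-dimensional torus\<close>

text \<open>
  Points are sequences of unimodular complex numbers, indexed from 0. The topology on
  \<^typ>\<open>nat \<Rightarrow> complex\<close> is the product topology, so \<open>torus_borel\<close> is the Borel sigma-algebra of the
  product topology on the torus.
\<close>

definition infinite_torus :: "(nat \<Rightarrow> complex) set" where
  "infinite_torus = {z. \<forall>n. z n \<in> sphere 0 1}"

definition torus_borel :: "(nat \<Rightarrow> complex) measure" where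
  "torus_borel = restrict_space borel infinite_torus"

text \<open>Normalized arc length \<open>d\<theta> / (2\<pi>)\<close> on the unit circle, and its countable product.\<close>

definition circle_haar :: "complex measure" where
  "circle_haar = distr (uniform_measure lborel {0..<2 * pi}) (restrict_space borel (sphere 0 1)) cis"

definition torus_haar :: "(nat \<Rightarrow> complex) measure" where
  "torus_haar = PiM UNIV (\<lambda>_. circle_haar)"

lemma prob_space_circle_haar: "prob_space circle_haar"
  unfolding circle_haar_def
proof (rule prob_space.prob_space_distr)
  show "prob_space (uniform_measure lborel {0..<2 * pi})"
    by (intro prob_space_uniform_measure) (auto simp: emeasure_lborel_Ico)
  have "cis \<in> borel_measurable borel"
    by (intro borel_measurable_continuous_onI continuous_intros)
  then show "cis \<in> measurable (uniform_measure lborel {0..<2 * pi})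
      (restrict_space borel (sphere 0 1))"
    by (intro measurable_restrict_space2) auto
qed

lemma prob_space_torus_haar: "prob_space torus_haar"
  unfolding torus_haar_def by (intro prob_space_PiM prob_space_circle_haar)

lemma space_torus_haar: "space torus_haar = infinite_torus"
  by (auto simp: torus_haar_def space_PiM circle_haar_def space_restrict_space
      infinite_torus_def PiE_def Pi_def)

lemma sets_circle_haar: "sets circle_haar = sets (restrict_space borel (sphere 0 1))"
  by (simp add: circle_haar_def)

lemma sets_torus_haar: "sets torus_haar = sets torus_borel"
proof (rule antisym)
  have space_borel: "space torus_borel = infinite_torus"
    by (simp add: torus_borel_def space_restrict_space)
  have coord: "(\<lambda>z. z n) \<in> measurable torus_borel circle_haar" for n
  proof -
    have "(\<lambda>z::nat \<Rightarrow> complex. z n) \<in> borel_measurable borel"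
      by (intro borel_measurable_continuous_onI continuous_on_product_coordinates)
    then have "(\<lambda>z. z n) \<in> measurable torus_borel (restrict_space borel (sphere 0 1))"
      unfolding torus_borel_def
      by (intro measurable_restrict_space2 measurable_restrict_space1)
        (auto simp: space_restrict_space infinite_torus_def)
    then show ?thesis
      using measurable_cong_sets[OF refl sets_circle_haar] by blast
  qed
  have "(\<lambda>z n. z n) \<in> measurable torus_borel torus_haar"
    unfolding torus_haar_def
    by (rule measurable_PiM_single') (use coord in \<open>auto dest: measurable_space\<close>)
  then have "(\<lambda>z n. z n) -` E \<inter> space torus_borel \<in> sets torus_borel"
    if "E \<in> sets torus_haar" for E
    using that by (rule measurable_sets)
  moreover have "(\<lambda>z n. z n) -` E \<inter> space torus_borel = E" if "E \<in> sets torus_haar" for E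
    using sets.sets_into_space[OF that] space_torus_haar space_borel by auto
  ultimately show "sets torus_haar \<subseteq> sets torus_borel"
    by auto
next
  have "(\<lambda>z. z) \<in> measurable torus_haar borel"
  proof (rule measurable_coordinatewise_then_product)
    fix n
    have "(\<lambda>z. z n) \<in> measurable torus_haar circle_haar"
      unfolding torus_haar_def by measurable
    then have "(\<lambda>z. z n) \<in> measurable torus_haar (restrict_space borel (sphere 0 1))"
      using measurable_cong_sets[OF refl sets_circle_haar] by blast
    then show "(\<lambda>z. z n) \<in> borel_measurable torus_haar"
      by (simp add: measurable_restrict_space2_iff)
  qed
  then show "sets torus_borel \<subseteq> sets torus_haar"
    using space_torus_haar
    by (auto simp: torus_borel_def sets_restrict_space Int_commute dest!: measurable_sets)
qed


section \<open>Analytic measures\<close>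

definition int_multi_indices :: "(nat \<Rightarrow> int) set" where
  "int_multi_indices = {\<nu>. finite {j. \<nu> j \<noteq> 0}}"

definition nonneg_multi_indices :: "(nat \<Rightarrow> int) set" where
  "nonneg_multi_indices = {\<nu> \<in> int_multi_indices. \<forall>j. \<nu> j \<ge> 0}"

definition torus_monomial :: "(nat \<Rightarrow> int) \<Rightarrow> (nat \<Rightarrow> complex) \<Rightarrow> complex" where
  "torus_monomial \<nu> z = (\<Prod>j | \<nu> j \<noteq> 0. z j powi \<nu> j)"

lemma torus_monomial_cis:
  assumes "\<nu> \<in> int_multi_indices"
  shows "torus_monomial \<nu> (\<lambda>j. cis (\<theta> j)) = exp (\<i> * of_real (\<Sum>j | \<nu> j \<noteq> 0. of_int (\<nu> j) * \<theta> j))"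
proof -
  have "torus_monomial \<nu> (\<lambda>j. cis (\<theta> j)) = (\<Prod>j | \<nu> j \<noteq> 0. exp (\<i> * of_real (of_int (\<nu> j) * \<theta> j)))"
    unfolding torus_monomial_def
    by (intro prod.cong refl) (simp only: cis_power_int, simp only: cis_conv_exp)
  also have "\<dots> = exp (\<Sum>j | \<nu> j \<noteq> 0. \<i> * of_real (of_int (\<nu> j) * \<theta> j))"
    using assms by (intro exp_sum[symmetric]) (simp add: int_multi_indices_def)
  also have "\<dots> = exp (\<i> * of_real (\<Sum>j | \<nu> j \<noteq> 0. of_int (\<nu> j) * \<theta> j))"
    by (simp only: of_real_sum sum_distrib_left)
  finally show ?thesis .
qed

lemma integrable_torus_monomial:
  assumes "finite_measure N" and sets: "sets N = sets torus_borel"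
  shows "integrable N (torus_monomial \<nu>)"
proof -
  interpret finite_measure N
    by fact
  have "(\<lambda>z :: nat \<Rightarrow> complex. z j) \<in> borel_measurable borel" for j
    by (intro borel_measurable_continuous_onI continuous_on_product_coordinates)
  then have [measurable]: "(\<lambda>z. z j) \<in> borel_measurable torus_borel" for j
    unfolding torus_borel_def by (rule measurable_restrict_space1)
  have "torus_monomial \<nu> \<in> borel_measurable torus_borel"
    unfolding torus_monomial_def power_int_def by measurable
  then have "torus_monomial \<nu> \<in> borel_measurable N"
    using measurable_cong_sets[OF sets refl] by blast
  moreover have "norm (torus_monomial \<nu> z) \<le> 1" if "z \<in> space N" for z
    using that sets_eq_imp_space_eq[OF sets]
    by (simp add: torus_monomial_def torus_borel_def space_restrict_space infinite_torus_def
        norm_power_int flip: prod_norm)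
  ultimately show ?thesis
    by (intro integrable_const_bound[of _ 1] AE_I2)
qed

definition fourier_coefficient ::
    "((nat \<Rightarrow> complex) set \<Rightarrow> complex) \<Rightarrow> (nat \<Rightarrow> int) \<Rightarrow> complex" where
  "fourier_coefficient \<mu> \<nu> = complex_measure_integral torus_borel \<mu> (torus_monomial (\<lambda>j. - \<nu> j))"

definition analytic_measure :: "((nat \<Rightarrow> complex) set \<Rightarrow> complex) \<Rightarrow> bool" where
  "analytic_measure \<mu> \<longleftrightarrow> vector_measure torus_borel \<mu> \<and>
     (\<forall>\<nu> \<in> int_multi_indices - nonneg_multi_indices. fourier_coefficient \<mu> \<nu> = 0)"

text \<open>
  The library constant \<open>absolutely_continuous\<close> only compares positive measures.
\<close>

definition vector_absolutely_continuous ::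
    "'a measure \<Rightarrow> ('a set \<Rightarrow> 'b::real_normed_vector) \<Rightarrow> bool" where
  "vector_absolutely_continuous M \<mu> \<longleftrightarrow> (\<forall>E \<in> null_sets M. \<mu> E = 0)"

end

theory Submission
  imports Defs
begin

text \<open>
  Write \<open>d\<mu> = h d\<sigma>\<close> with a finite positive measure \<open>\<sigma>\<close>, and choose a Haar null set \<open>E\<close> that
  absorbs every other Haar null set up to a \<open>\<sigma>\<close>-null set. Then \<open>1\<^sub>E \<mu>\<close> is the singular part of
  \<open>\<mu>\<close>, and the claim is that it vanishes.

  The analytic input is a theorem of F. and M. Riesz type for a half-space \<open>P\<close>, that is, for a set
  of positive elements of a total group order on the multi-indices
  (\<open>integral_singular_part_eq_0\<close>): if \<open>\<integral> h z\<^sup>\<nu> d\<sigma> = 0\<close> for all \<open>\<nu> \<in> P\<close>, then the singular part of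
  \<open>h d\<sigma>\<close> has total mass zero. For the proof, let \<open>K \<subseteq> E\<close> be closed. A continuous function of small
  Haar mean that is large on \<open>K\<close> is approximated by a real trigonometric polynomial, which because of
  the total order is a constant plus the real part of a polynomial \<open>F\<close> with spectrum in \<open>P\<close>. The
  function \<open>g = exp (- F)\<close> is bounded by almost 1, is close to 0 on \<open>K\<close>, and has Haar mean 1,
  hence is close to 1 in \<open>L\<^sup>2\<close> of the Haar measure. Moreover \<open>\<integral> h g d\<sigma> = \<integral> h d\<sigma>\<close>, because
  \<open>g - 1\<close> is a uniform limit of polynomials with spectrum in \<open>P\<close>. Letting \<open>K\<close> exhaust \<open>E\<close>, a
  subsequence of the \<open>g\<close> tends to the indicator of the complement of \<open>E\<close>, and dominated
  convergence gives \<open>\<integral> h d\<sigma> = \<integral> (1 - 1\<^sub>E) h d\<sigma>\<close>.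

  The theorem is applied with two kinds of half-spaces. Comparing the \<open>j\<close>-th entries first shows that
  \<open>1\<^sub>E \<mu>\<close> is again analytic. Comparing a weighted degree first gives an order in which every
  non-negative multi-index has only finitely many non-negative multi-indices below it. If all
  coefficients of \<open>1\<^sub>E \<mu>\<close> below \<open>\<nu>\<close> vanish, then \<open>z\<^sup>-\<^sup>\<nu> 1\<^sub>E \<mu>\<close> satisfies the hypothesis of the
  theorem, is its own singular part, and so has mass zero: the coefficient at \<open>\<nu>\<close> vanishes as well.
  By induction all Fourier coefficients of \<open>1\<^sub>E \<mu>\<close> are zero, and hence so is \<open>1\<^sub>E \<mu>\<close>.
\<close>

section \<open>Complex measures as densities\<close>

lemma exists_finite_measure_sum:
  assumes "finite_measure N1" "finite_measure N2" and s: "sets N1 = sets M" "sets N2 = sets M"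
  obtains N where "finite_measure N" "sets N = sets M"
    "\<And>A. A \<in> sets M \<Longrightarrow> emeasure N A = emeasure N1 A + emeasure N2 A"
proof -
  define N where "N = measure_of (space M) (sets M) (\<lambda>A. emeasure N1 A + emeasure N2 A)"
  have sN: "sets N = sets M" "space N = space M"
    by (simp_all add: N_def)
  have "countably_additive (sets M) (\<lambda>A. emeasure N1 A + emeasure N2 A)"
    unfolding countably_additive_def
  proof (intro allI impI)
    fix A :: "nat \<Rightarrow> 'a set"
    assume A: "range A \<subseteq> sets M" "disjoint_family A"
    then have "(\<Sum>i. emeasure N1 (A i)) = emeasure N1 (\<Union>i. A i)"
      "(\<Sum>i. emeasure N2 (A i)) = emeasure N2 (\<Union>i. A i)"
      using s by (auto intro!: suminf_emeasure)
    then show "(\<Sum>i. emeasure N1 (A i) + emeasure N2 (A i)) =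
        emeasure N1 (\<Union>i. A i) + emeasure N2 (\<Union>i. A i)"
      by (subst suminf_add[symmetric]) simp_all
  qed
  then have em: "emeasure N A = emeasure N1 A + emeasure N2 A" if "A \<in> sets M" for A
    using that unfolding N_def
    by (intro emeasure_measure_of_sigma sets.sigma_algebra_axioms) (auto simp: positive_def)
  have "finite_measure N"
    using em[of "space M"] sN finite_measure.emeasure_finite[OF assms(1)]
      finite_measure.emeasure_finite[OF assms(2)]
    by (intro finite_measureI) (simp add: ennreal_add_eq_top)
  then show thesis
    using that sN em by blast
qed

text \<open>
  The Radon-Nikodym derivative is taken real-valued so that it can be used as a factor of a complex
  integrand.
\<close>

lemma density_of_dominated_finite_measure:
  assumes "finite_measure S" "finite_measure N" and s: "sets N = sets S"
    and ac: "\<And>A. A \<in> sets S \<Longrightarrow> emeasure N A \<le> emeasure S A"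
  obtains D :: "'a \<Rightarrow> real" where "integrable S D"
    "\<And>f :: 'a \<Rightarrow> complex. f \<in> borel_measurable S \<Longrightarrow> (\<integral>x. f x \<partial>N) = (\<integral>x. D x *\<^sub>R f x \<partial>S)"
proof -
  interpret S: finite_measure S by fact
  interpret N: finite_measure N by fact
  have ac: "absolutely_continuous S N"
    unfolding absolutely_continuous_def
  proof
    fix A assume A: "A \<in> null_sets S"
    then have "emeasure N A \<le> 0"
      using ac[of A] by (auto simp: null_sets_def)
    then show "A \<in> null_sets N"
      using A s by (auto simp: null_sets_def)
  qed
  obtain D where D: "D \<in> borel_measurable S" "AE x in S. RN_deriv S N x = ennreal (D x)"
    "\<And>x. 0 \<le> D x"
    using S.real_RN_deriv[OF N.finite_measure_axioms ac s] by blast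
  have "N = density S (RN_deriv S N)"
    using S.density_RN_deriv[OF ac s] by simp
  also have "\<dots> = density S D"
    using D by (intro density_cong) auto
  finally have N: "N = density S D" .
  have "integrable N (\<lambda>_. 1::real)"
    by simp
  then have "integrable S D"
    unfolding N using D by (subst (asm) integrable_density) auto
  moreover have "(\<integral>x. f x \<partial>N) = (\<integral>x. D x *\<^sub>R f x \<partial>S)" if "f \<in> borel_measurable S"
    for f :: "'a \<Rightarrow> complex"
    unfolding N using that D by (intro integral_density) auto
  ultimately show thesis
    using that by blast
qed

text \<open>
  The four parts of the Jordan decompositions of \<open>Re \<mu>\<close> and \<open>Im \<mu>\<close> are all dominated by their sum
  \<open>S\<close>, so \<open>\<mu>\<close> has a density \<open>h\<close> with respect to \<open>S\<close>. With a single positive measure, null sets and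
  dominated convergence are those of \<open>S\<close>.
\<close>

lemma complex_measure_has_density:
  fixes \<mu> :: "'a set \<Rightarrow> complex"
  assumes \<mu>: "vector_measure M \<mu>"
  obtains S h where "finite_measure S" "sets S = sets M" "integrable S h"
    "\<forall>f\<in>borel_measurable M. (\<exists>B. \<forall>x\<in>space M. norm (f x) \<le> B) \<longrightarrow>
       complex_measure_integral M \<mu> f = (\<integral>x. h x * f x \<partial>S)"
proof -
  define N1 where "N1 = positive_part M (\<lambda>A. Re (\<mu> A))"
  define N2 where "N2 = positive_part M (\<lambda>A. - Re (\<mu> A))"
  define N3 where "N3 = positive_part M (\<lambda>A. Im (\<mu> A))"
  define N4 where "N4 = positive_part M (\<lambda>A. - Im (\<mu> A))"
  note defs = N1_def N2_def N3_def N4_def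
  have fin: "finite_measure N1" "finite_measure N2" "finite_measure N3" "finite_measure N4"
    unfolding defs using \<mu>
    by (auto intro!: finite_measure_positive_part vector_measure_uminus
        vector_measure_Re vector_measure_Im)
  have sets: "sets N1 = sets M" "sets N2 = sets M" "sets N3 = sets M" "sets N4 = sets M"
    by (simp_all add: defs)
  obtain S1 where S1: "finite_measure S1" "sets S1 = sets M"
    "\<And>A. A \<in> sets M \<Longrightarrow> emeasure S1 A = emeasure N1 A + emeasure N2 A"
    using exists_finite_measure_sum[OF fin(1,2) sets(1,2)] by blast
  obtain S2 where S2: "finite_measure S2" "sets S2 = sets M"
    "\<And>A. A \<in> sets M \<Longrightarrow> emeasure S2 A = emeasure N3 A + emeasure N4 A"
    using exists_finite_measure_sum[OF fin(3,4) sets(3,4)] by blast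
  obtain S where S: "finite_measure S" "sets S = sets M"
    "\<And>A. A \<in> sets M \<Longrightarrow> emeasure S A = emeasure S1 A + emeasure S2 A"
    using exists_finite_measure_sum[OF S1(1) S2(1) S1(2) S2(2)] by blast
  interpret S: finite_measure S by fact
  have le: "emeasure N1 A \<le> emeasure S A" "emeasure N2 A \<le> emeasure S A"
    "emeasure N3 A \<le> emeasure S A" "emeasure N4 A \<le> emeasure S A" if "A \<in> sets S" for A
    using that by (auto simp: S S1 S2 ac_simps intro: add_increasing add_increasing2)
  note dens = density_of_dominated_finite_measure[OF S(1)]
  obtain D1 where D1: "integrable S D1"
    "\<And>f :: 'a \<Rightarrow> complex. f \<in> borel_measurable S \<Longrightarrow> (\<integral>x. f x \<partial>N1) = (\<integral>x. D1 x *\<^sub>R f x \<partial>S)"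
    using dens[OF fin(1)] sets S(2) le(1) by metis
  obtain D2 where D2: "integrable S D2"
    "\<And>f :: 'a \<Rightarrow> complex. f \<in> borel_measurable S \<Longrightarrow> (\<integral>x. f x \<partial>N2) = (\<integral>x. D2 x *\<^sub>R f x \<partial>S)"
    using dens[OF fin(2)] sets S(2) le(2) by metis
  obtain D3 where D3: "integrable S D3"
    "\<And>f :: 'a \<Rightarrow> complex. f \<in> borel_measurable S \<Longrightarrow> (\<integral>x. f x \<partial>N3) = (\<integral>x. D3 x *\<^sub>R f x \<partial>S)"
    using dens[OF fin(3)] sets S(2) le(3) by metis
  obtain D4 where D4: "integrable S D4"
    "\<And>f :: 'a \<Rightarrow> complex. f \<in> borel_measurable S \<Longrightarrow> (\<integral>x. f x \<partial>N4) = (\<integral>x. D4 x *\<^sub>R f x \<partial>S)"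
    using dens[OF fin(4)] sets S(2) le(4) by metis
  define h where "h x = complex_of_real (D1 x - D2 x) + \<i> * of_real (D3 x - D4 x)" for x
  have "integrable S h"
    unfolding h_def using D1(1) D2(1) D3(1) D4(1)
    by (intro Bochner_Integration.integrable_add integrable_mult_right integrable_of_real
        Bochner_Integration.integrable_diff)
  then show thesis
  proof (rule that[OF S(1,2)], intro ballI impI, elim exE)
    fix f :: "'a \<Rightarrow> complex" and B
    assume f: "f \<in> borel_measurable M" and B: "\<forall>x\<in>space M. norm (f x) \<le> B"
    have fS [measurable]: "f \<in> borel_measurable S"
      using f measurable_cong_sets[OF S(2) refl] by blast
    have int: "integrable S (\<lambda>x. D x *\<^sub>R f x)" if D: "integrable S D" for D :: "'a \<Rightarrow> real"
    proof (rule Bochner_Integration.integrable_bound)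
      show "integrable S (\<lambda>x. B * D x)"
        using D by simp
      show "(\<lambda>x. D x *\<^sub>R f x) \<in> borel_measurable S"
        using D by measurable
      show "AE x in S. norm (D x *\<^sub>R f x) \<le> norm (B * D x)"
      proof (rule AE_I2)
        fix x assume "x \<in> space S"
        then have "norm (f x) \<le> \<bar>B\<bar>"
          using B sets_eq_imp_space_eq[OF S(2)] by force
        then show "norm (D x *\<^sub>R f x) \<le> norm (B * D x)"
          by (simp add: abs_mult mult.commute[of "\<bar>B\<bar>"] mult_left_mono)
      qed
    qed
    note ints = int[OF D1(1)] int[OF D2(1)] int[OF D3(1)] int[OF D4(1)]
    have "complex_measure_integral M \<mu> f =
        ((\<integral>x. D1 x *\<^sub>R f x \<partial>S) - (\<integral>x. D2 x *\<^sub>R f x \<partial>S)) +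
        \<i> * ((\<integral>x. D3 x *\<^sub>R f x \<partial>S) - (\<integral>x. D4 x *\<^sub>R f x \<partial>S))"
      unfolding complex_measure_integral_def signed_integral_def defs[symmetric]
      by (simp add: D1(2) D2(2) D3(2) D4(2) fS)
    also have "\<dots> = (\<integral>x. (D1 x *\<^sub>R f x - D2 x *\<^sub>R f x) + \<i> * (D3 x *\<^sub>R f x - D4 x *\<^sub>R f x) \<partial>S)"
      using ints by simp
    also have "\<dots> = (\<integral>x. h x * f x \<partial>S)"
      by (intro Bochner_Integration.integral_cong)
        (auto simp: h_def scaleR_conv_of_real algebra_simps)
    finally show "complex_measure_integral M \<mu> f = (\<integral>x. h x * f x \<partial>S)" .
  qed
qed

text \<open>
  The restriction of \<open>S\<close> to \<open>E\<close> is the singular part of \<open>S\<close> with respect to \<open>H\<close>. Such a set \<open>E\<close> arises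
  by exhaustion, as a countable union of null sets whose \<open>S\<close>-measures approach the supremum.
\<close>

lemma exists_largest_null_set:
  assumes "finite_measure S" and s: "sets S = sets H"
  obtains E where "E \<in> null_sets H" "\<And>F. F \<in> null_sets H \<Longrightarrow> F - E \<in> null_sets S"
proof -
  interpret S: finite_measure S by fact
  define V where "V = measure S ` null_sets H"
  have ne: "V \<noteq> {}" and bdd: "bdd_above V"
    using S.bounded_measure by (auto simp: V_def intro!: bdd_aboveI2[of _ _ "measure S (space S)"])
  have "\<exists>E. E \<in> null_sets H \<and> Sup V - 1 / Suc n < measure S E" for n
    using less_cSup_iff[OF ne bdd, of "Sup V - 1 / Suc n"] by (auto simp: V_def)
  then obtain E where E: "\<And>n::nat. E n \<in> null_sets H" "\<And>n. Sup V - 1 / Suc n < measure S (E n)"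
    by metis
  define E0 where "E0 = (\<Union>n. E n)"
  have E0: "E0 \<in> null_sets H"
    unfolding E0_def using E by (intro null_sets_UN) auto
  have meas [measurable]: "F \<in> sets S" if "F \<in> null_sets H" for F
    using that s by auto
  have ge: "Sup V \<le> measure S E0"
  proof (rule field_le_epsilon)
    fix e :: real assume "e > 0"
    then obtain n where n: "1 / Suc n < e"
      by (metis nat_approx_posE)
    have "measure S (E n) \<le> measure S E0"
      using E0 by (intro S.finite_measure_mono) (auto simp: E0_def meas)
    then show "Sup V \<le> measure S E0 + e"
      using E(2)[of n] n by linarith
  qed
  have "F - E0 \<in> null_sets S" if F: "F \<in> null_sets H" for F
  proof -
    have FE: "F \<union> E0 \<in> null_sets H"
      using F E0 by auto
    then have "measure S (F \<union> E0) \<le> Sup V"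
      unfolding V_def by (intro cSup_upper) (use bdd in \<open>auto simp: V_def\<close>)
    moreover have "measure S (F \<union> E0) = measure S E0 + measure S (F - E0)"
      using S.finite_measure_Union[of E0 "F - E0"] meas[OF F] meas[OF E0] by (simp add: Un_commute)
    ultimately have "measure S (F - E0) = 0"
      using ge measure_nonneg[of S "F - E0"] by linarith
    then show ?thesis
      using meas[OF F] meas[OF E0] by (auto simp: null_sets_def S.emeasure_eq_measure)
  qed
  then show thesis
    using that E0 by blast
qed

section \<open>Monomials on the infinite torus\<close>

lemma space_torus_borel: "space torus_borel = infinite_torus"
  by (simp add: torus_borel_def space_restrict_space)

text \<open>
  Tychonoff's theorem, transferred from the abstract product topology.
\<close>

lemma compact_infinite_torus: "compact infinite_torus"
proof -
  have "compactin (product_topology (\<lambda>_::nat. euclidean) UNIV)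
      (PiE UNIV (\<lambda>_. sphere (0::complex) 1))"
    by (simp add: compactin_PiE compactin_euclidean_iff)
  moreover have "PiE UNIV (\<lambda>_. sphere (0::complex) 1) = infinite_torus"
    by (auto simp: infinite_torus_def PiE_def Pi_def)
  ultimately show ?thesis
    by (simp add: euclidean_product_topology compactin_euclidean_iff)
qed

lemma norm_torus_coordinate: "z \<in> infinite_torus \<Longrightarrow> norm (z j) = 1"
  by (simp add: infinite_torus_def)

lemma torus_coordinate_nonzero: "z \<in> infinite_torus \<Longrightarrow> z j \<noteq> 0"
  by (metis norm_torus_coordinate norm_zero zero_neq_one)

lemma norm_torus_monomial: "z \<in> infinite_torus \<Longrightarrow> norm (torus_monomial \<nu> z) = 1"
  by (simp add: torus_monomial_def norm_torus_coordinate norm_power_int flip: prod_norm)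

lemma continuous_on_torus_monomial: "continuous_on infinite_torus (torus_monomial \<nu>)"
  unfolding torus_monomial_def
  by (intro continuous_intros continuous_on_subset[OF continuous_on_product_coordinates subset_UNIV])
    (auto dest: torus_coordinate_nonzero)

lemma torus_monomial_superset:
  assumes "finite I" "{j. \<nu> j \<noteq> 0} \<subseteq> I"
  shows "torus_monomial \<nu> z = (\<Prod>j\<in>I. z j powi \<nu> j)"
  unfolding torus_monomial_def using assms by (intro prod.mono_neutral_left) auto

lemma torus_monomial_zero [simp]: "torus_monomial (\<lambda>_. 0) z = 1"
  by (simp add: torus_monomial_def)

lemma multi_index_add:
  assumes "\<nu> \<in> int_multi_indices" "\<kappa> \<in> int_multi_indices"
  shows "(\<lambda>j. \<nu> j + \<kappa> j) \<in> int_multi_indices"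
  using assms unfolding int_multi_indices_def
  by (auto intro: finite_subset[of _ "{j. \<nu> j \<noteq> 0} \<union> {j. \<kappa> j \<noteq> 0}"])

lemma multi_index_uminus: "(\<lambda>j. - \<nu> j) \<in> int_multi_indices \<longleftrightarrow> \<nu> \<in> int_multi_indices"
  by (simp add: int_multi_indices_def)

lemma torus_monomial_mult:
  assumes "\<nu> \<in> int_multi_indices" "\<kappa> \<in> int_multi_indices" "z \<in> infinite_torus"
  shows "torus_monomial \<nu> z * torus_monomial \<kappa> z = torus_monomial (\<lambda>j. \<nu> j + \<kappa> j) z"
proof -
  define I where "I = {j. \<nu> j \<noteq> 0} \<union> {j. \<kappa> j \<noteq> 0}"
  have I: "finite I"
    using assms by (simp add: I_def int_multi_indices_def)
  have "torus_monomial \<nu> z * torus_monomial \<kappa> z = (\<Prod>j\<in>I. z j powi \<nu> j * z j powi \<kappa> j)"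
    unfolding prod.distrib using I by (simp add: torus_monomial_superset[of I] I_def)
  also have "\<dots> = (\<Prod>j\<in>I. z j powi (\<nu> j + \<kappa> j))"
    using assms(3) by (simp add: power_int_add torus_coordinate_nonzero)
  also have "\<dots> = torus_monomial (\<lambda>j. \<nu> j + \<kappa> j) z"
    using I by (intro torus_monomial_superset[symmetric]) (auto simp: I_def)
  finally show ?thesis .
qed

lemma cnj_torus_monomial:
  assumes "z \<in> infinite_torus"
  shows "cnj (torus_monomial \<nu> z) = torus_monomial (\<lambda>j. - \<nu> j) z"
proof -
  have "cnj (z j) = inverse (z j)" for j
    using norm_torus_coordinate[OF assms, of j]
    by (metis complex_cnj_cnj divide_conv_cnj inverse_eq_divide mult_1)
  then show ?thesis
    by (simp add: torus_monomial_def power_int_minus power_int_inverse)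
qed

lemma integral_circle_haar_power_int:
  assumes "k \<noteq> 0"
  shows "integrable circle_haar (\<lambda>z. z powi k)" "(\<integral>z. z powi k \<partial>circle_haar) = 0"
proof -
  interpret prob_space circle_haar by (rule prob_space_circle_haar)
  have sp: "space circle_haar = sphere 0 1"
    by (simp add: circle_haar_def space_restrict_space)
  have "(\<lambda>z::complex. z powi k) \<in> borel_measurable (restrict_space borel (sphere 0 1))"
    by (intro borel_measurable_continuous_on_restrict continuous_intros) auto
  then have m: "(\<lambda>z::complex. z powi k) \<in> borel_measurable circle_haar"
    using measurable_cong_sets[OF sets_circle_haar refl] by blast
  show "integrable circle_haar (\<lambda>z. z powi k)"
    by (rule integrable_const_bound[of _ 1]) (auto simp: m norm_power_int sp intro!: AE_I2)
  define F where "F t = cis (of_int k * t) / (\<i> * of_int k)" for t :: real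
  have "cis \<in> borel_measurable borel"
    by (intro borel_measurable_continuous_onI continuous_intros)
  then have cis: "cis \<in> measurable (uniform_measure lborel {0..<2 * pi})
      (restrict_space borel (sphere 0 1))"
    by (intro measurable_restrict_space2) auto
  have um: "uniform_measure lborel {0..<2 * pi} =
      density lborel (\<lambda>t. indicator {0..<2 * pi} t / (2 * pi))"
    unfolding uniform_measure_def using divide_ennreal[of 1 "2 * pi"]
    by (intro density_cong) (auto simp: emeasure_lborel_Ico split: split_indicator)
  have meas: "(\<lambda>t. cis (of_int k * t)) \<in> borel_measurable borel"
    by (intro borel_measurable_continuous_onI continuous_intros)
  have "(\<integral>z. z powi k \<partial>circle_haar) = (\<integral>t. cis t powi k \<partial>uniform_measure lborel {0..<2 * pi})"
    unfolding circle_haar_def using m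
    by (intro integral_distr cis) (simp add: circle_haar_def)
  also have "\<dots> = (\<integral>t. cis (of_int k * t) \<partial>uniform_measure lborel {0..<2 * pi})"
    by (simp add: cis_power_int)
  also have "\<dots> = (\<integral>t. (indicator {0..<2 * pi} t / (2 * pi)) *\<^sub>R cis (of_int k * t) \<partial>lborel)"
    unfolding um using meas by (intro integral_density) auto
  also have "\<dots> = (\<integral>t. (1 / (2 * pi)) *\<^sub>R (indicator {0..2 * pi} t *\<^sub>R cis (of_int k * t)) \<partial>lborel)"
  proof (rule integral_cong_AE)
    have "AE t in lborel. t \<noteq> 2 * pi"
      by (rule AE_lborel_singleton)
    then show "AE t in lborel. (indicator {0..<2 * pi} t / (2 * pi)) *\<^sub>R cis (of_int k * t) =
        (1 / (2 * pi)) *\<^sub>R (indicator {0..2 * pi} t *\<^sub>R cis (of_int k * t))"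
      by eventually_elim (auto split: split_indicator)
  qed (use meas in auto)
  also have "\<dots> = (1 / (2 * pi)) *\<^sub>R (\<integral>t. indicator {0..2 * pi} t *\<^sub>R cis (of_int k * t) \<partial>lborel)"
    by (rule integral_scaleR_right)
  also have "(\<integral>t. indicator {0..2 * pi} t *\<^sub>R cis (of_int k * t) \<partial>lborel) = F (2 * pi) - F 0"
  proof (rule integral_FTC_Icc)
    show "(F has_vector_derivative cis (of_int k * t)) (at t within {0..2 * pi})" for t
    proof -
      have "((\<lambda>t. exp (\<i> * (of_int k * of_real t)) / (\<i> * of_int k)) has_vector_derivative
          (exp (\<i> * (of_int k * of_real t)) * (\<i> * of_int k) / (\<i> * of_int k)))
          (at t within {0..2 * pi})"
        by (rule has_vector_derivative_real_field)
          (auto intro!: derivative_eq_intros simp: assms field_simps)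
      then show ?thesis
        using assms by (simp add: F_def[abs_def] cis_conv_exp)
    qed
  qed (auto intro!: continuous_intros)
  also have "F (2 * pi) = F 0"
  proof -
    have "cis (of_int k * (2 * pi)) = 1"
      using cis_multiple_2pi[of "of_int k"] by (simp add: ac_simps)
    then show ?thesis
      by (simp add: F_def)
  qed
  finally show "(\<integral>z. z powi k \<partial>circle_haar) = 0"
    by simp
qed

text \<open>
  A monomial depends on finitely many coordinates only, so its mean is a finite product of means over the
  circle, each of which is zero.
\<close>

lemma integral_torus_haar_monomial:
  assumes "\<nu> \<in> int_multi_indices" "\<nu> \<noteq> (\<lambda>_. 0)"
  shows "(\<integral>z. torus_monomial \<nu> z \<partial>torus_haar) = 0"
proof -
  interpret product_prob_space "\<lambda>_. circle_haar" UNIV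
    by (intro product_prob_spaceI prob_space_circle_haar)
  interpret fin: finite_product_prob_space "\<lambda>_. circle_haar" "{j. \<nu> j \<noteq> 0}"
    using assms by unfold_locales (simp add: int_multi_indices_def)
  define J where "J = {j. \<nu> j \<noteq> 0}"
  have J: "finite J" "J \<noteq> {}"
    using assms by (auto simp: J_def int_multi_indices_def)
  have [measurable]: "(\<lambda>z. z powi \<nu> j) \<in> borel_measurable circle_haar" if "j \<in> J" for j
    using integral_circle_haar_power_int(1)[of "\<nu> j"] that by (auto simp: J_def)
  have m: "(\<lambda>x. \<Prod>j\<in>J. x j powi \<nu> j) \<in> borel_measurable (PiM J (\<lambda>_. circle_haar))"
    by measurable
  have "(\<integral>z. torus_monomial \<nu> z \<partial>torus_haar) =
      (\<integral>z. (\<Prod>j\<in>J. restrict z J j powi \<nu> j) \<partial>torus_haar)"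
    by (intro Bochner_Integration.integral_cong) (auto simp: torus_monomial_def J_def)
  also have "\<dots> = (\<integral>x. (\<Prod>j\<in>J. x j powi \<nu> j)
      \<partial>distr torus_haar (PiM J (\<lambda>_. circle_haar)) (\<lambda>z. restrict z J))"
    unfolding torus_haar_def
    by (intro integral_distr[symmetric] m measurable_restrict_subset) auto
  also have "\<dots> = (\<integral>x. (\<Prod>j\<in>J. x j powi \<nu> j) \<partial>PiM J (\<lambda>_. circle_haar))"
    unfolding torus_haar_def by (subst distr_PiM_restrict_finite) (use J in auto)
  also have "\<dots> = (\<Prod>j\<in>J. \<integral>z. z powi \<nu> j \<partial>circle_haar)"
    by (intro product_integral_prod integral_circle_haar_power_int J) (auto simp: J_def)
  also have "\<dots> = 0"
    using J(2) integral_circle_haar_power_int(2) by (intro prod_zero J(1)) (auto simp: J_def)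
  finally show ?thesis .
qed

lemma space_torus: "sets S = sets torus_borel \<Longrightarrow> space S = infinite_torus"
  using sets_eq_imp_space_eq space_torus_borel by metis

lemma borel_measurable_torus_continuous:
  fixes f :: "(nat \<Rightarrow> complex) \<Rightarrow> 'a::topological_space"
  assumes "sets S = sets torus_borel" "continuous_on infinite_torus f"
  shows "f \<in> borel_measurable S"
  using borel_measurable_continuous_on_restrict[OF assms(2)] measurable_cong_sets[OF assms(1) refl]
  by (auto simp: torus_borel_def)

lemma bounded_on_torus:
  fixes f :: "(nat \<Rightarrow> complex) \<Rightarrow> 'a::real_normed_vector"
  assumes "continuous_on infinite_torus f"
  obtains B where "\<And>z. z \<in> infinite_torus \<Longrightarrow> norm (f z) \<le> B"
proof -
  have "bounded (f ` infinite_torus)"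
    using assms compact_infinite_torus by (intro compact_imp_bounded compact_continuous_image)
  then obtain B where "B > 0" "\<forall>x\<in>f ` infinite_torus. norm x \<le> B"
    by (auto simp: bounded_pos)
  then show thesis
    using that[of B] by auto
qed

text \<open>
  Densities are merely integrable while test functions are bounded, so products of the two are integrable.
\<close>

lemma integrable_mult_bounded:
  fixes h f :: "'a \<Rightarrow> complex"
  assumes "integrable S h" and [measurable]: "f \<in> borel_measurable S"
    and B: "\<And>z. z \<in> space S \<Longrightarrow> norm (f z) \<le> B"
  shows "integrable S (\<lambda>z. h z * f z)"
proof (rule Bochner_Integration.integrable_bound)
  show "integrable S (\<lambda>x. \<bar>B\<bar> * norm (h x))"
    using assms by simp
  show "AE z in S. norm (h z * f z) \<le> norm (\<bar>B\<bar> * norm (h z))"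
    using B by (intro AE_I2) (force simp: norm_mult mult.commute intro!: mult_right_mono)
  show "(\<lambda>z. h z * f z) \<in> borel_measurable S"
    using assms(1) by measurable
qed

lemma integrable_mult_continuous:
  fixes h f :: "(nat \<Rightarrow> complex) \<Rightarrow> complex"
  assumes "integrable S h" and s: "sets S = sets torus_borel" and f: "continuous_on infinite_torus f"
  shows "integrable S (\<lambda>z. h z * f z)"
proof -
  obtain B where "\<And>z. z \<in> infinite_torus \<Longrightarrow> norm (f z) \<le> B"
    using bounded_on_torus[OF f] by metis
  then show ?thesis
    using assms by (intro integrable_mult_bounded[of _ _ _ B] borel_measurable_torus_continuous[OF s f])
      (auto simp: space_torus)
qed

section \<open>Half-spaces of multi-indices\<close>

text \<open>
  The strictly positive elements of a total order on the multi-indices that is compatible with addition.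
\<close>

definition half_space :: "(nat \<Rightarrow> int) set \<Rightarrow> bool" where
  "half_space P \<longleftrightarrow> P \<subseteq> int_multi_indices \<and> (\<lambda>_. 0) \<notin> P \<and>
     (\<forall>\<nu>\<in>P. \<forall>\<kappa>\<in>P. (\<lambda>j. \<nu> j + \<kappa> j) \<in> P) \<and>
     (\<forall>\<nu>\<in>int_multi_indices. \<nu> \<noteq> (\<lambda>_. 0) \<longrightarrow> \<nu> \<in> P \<or> (\<lambda>j. - \<nu> j) \<in> P)"

definition lex_positive :: "(nat \<Rightarrow> int) \<Rightarrow> bool" where
  "lex_positive \<nu> \<longleftrightarrow> (\<exists>i. \<nu> i > 0 \<and> (\<forall>j<i. \<nu> j = 0))"

text \<open>
  The order that compares the values of an additive functional \<open>d\<close> and breaks ties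
  lexicographically, the entry of least index being the most significant one. It turns any additive
  \<open>d\<close> into a total order.
\<close>

definition graded_half_space :: "((nat \<Rightarrow> int) \<Rightarrow> int) \<Rightarrow> (nat \<Rightarrow> int) set" where
  "graded_half_space d = {\<nu> \<in> int_multi_indices. d \<nu> > 0 \<or> d \<nu> = 0 \<and> lex_positive \<nu>}"

lemma lex_positive_add:
  assumes "lex_positive \<nu>" "lex_positive \<kappa>"
  shows "lex_positive (\<lambda>j. \<nu> j + \<kappa> j)"
proof -
  obtain a b where ab: "\<nu> a > 0" "\<forall>j<a. \<nu> j = 0" "\<kappa> b > 0" "\<forall>j<b. \<kappa> j = 0"
    using assms by (auto simp: lex_positive_def)
  have "a < b \<or> a = b \<or> b < a"
    by linarith
  then show ?thesis
    unfolding lex_positive_def using ab by (intro exI[of _ "min a b"]) auto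
qed

lemma lex_positive_cases:
  assumes "\<nu> \<noteq> (\<lambda>_. 0)"
  shows "lex_positive \<nu> \<or> lex_positive (\<lambda>j. - \<nu> j)"
proof -
  define i where "i = (LEAST i. \<nu> i \<noteq> 0)"
  have "\<exists>i. \<nu> i \<noteq> 0"
    using assms by auto
  then have "\<nu> i \<noteq> 0"
    unfolding i_def by (rule LeastI_ex)
  moreover have "\<nu> j = 0" if "j < i" for j
    using that not_less_Least unfolding i_def by blast
  moreover have "\<nu> i > 0 \<or> - \<nu> i > 0"
    using calculation(1) by linarith
  ultimately show ?thesis
    unfolding lex_positive_def by (metis neg_equal_0_iff_equal)
qed

lemma half_space_graded:
  assumes d: "\<And>\<nu> \<kappa>. \<nu> \<in> int_multi_indices \<Longrightarrow> \<kappa> \<in> int_multi_indices \<Longrightarrow> d (\<lambda>j. \<nu> j + \<kappa> j) = d \<nu> + d \<kappa>"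
  shows "half_space (graded_half_space d)"
proof -
  have zero: "(\<lambda>_. 0) \<in> int_multi_indices"
    by (simp add: int_multi_indices_def)
  have d0: "d (\<lambda>_. 0) = 0"
    using d[OF zero zero] by simp
  have d_uminus: "d (\<lambda>j. - \<nu> j) = - d \<nu>" if "\<nu> \<in> int_multi_indices" for \<nu>
    using d[OF that multi_index_uminus[THEN iffD2, OF that]] d0 by simp
  show ?thesis
    unfolding half_space_def
  proof (intro conjI ballI impI)
    show "graded_half_space d \<subseteq> int_multi_indices"
      by (auto simp: graded_half_space_def)
    show "(\<lambda>_. 0) \<notin> graded_half_space d"
      using d0 by (simp add: graded_half_space_def lex_positive_def)
    show "(\<lambda>j. \<nu> j + \<kappa> j) \<in> graded_half_space d"
      if "\<nu> \<in> graded_half_space d" "\<kappa> \<in> graded_half_space d" for \<nu> \<kappa>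
      using that d[of \<nu> \<kappa>] lex_positive_add[of \<nu> \<kappa>] multi_index_add[of \<nu> \<kappa>]
      by (auto simp: graded_half_space_def)
    show "\<nu> \<in> graded_half_space d \<or> (\<lambda>j. - \<nu> j) \<in> graded_half_space d"
      if "\<nu> \<in> int_multi_indices" "\<nu> \<noteq> (\<lambda>_. 0)" for \<nu>
      using that d_uminus[of \<nu>] lex_positive_cases[of \<nu>] multi_index_uminus[of \<nu>]
      by (auto simp: graded_half_space_def)
  qed
qed

text \<open>
  The weights tend to infinity, which makes the non-negative multi-indices of bounded degree a finite
  set although there are infinitely many variables.
\<close>

definition weighted_degree :: "(nat \<Rightarrow> int) \<Rightarrow> int" where
  "weighted_degree \<nu> = (\<Sum>j | \<nu> j \<noteq> 0. (int j + 1) * \<nu> j)"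

lemma weighted_degree_add:
  assumes "\<nu> \<in> int_multi_indices" "\<kappa> \<in> int_multi_indices"
  shows "weighted_degree (\<lambda>j. \<nu> j + \<kappa> j) = weighted_degree \<nu> + weighted_degree \<kappa>"
proof -
  define I where "I = {j. \<nu> j \<noteq> 0} \<union> {j. \<kappa> j \<noteq> 0}"
  have I: "finite I"
    using assms by (simp add: I_def int_multi_indices_def)
  have *: "weighted_degree \<rho> = (\<Sum>j\<in>I. (int j + 1) * \<rho> j)" if "{j. \<rho> j \<noteq> 0} \<subseteq> I" for \<rho>
    unfolding weighted_degree_def using I that by (intro sum.mono_neutral_left) auto
  have "{j. \<nu> j + \<kappa> j \<noteq> 0} \<subseteq> I" "{j. \<nu> j \<noteq> 0} \<subseteq> I" "{j. \<kappa> j \<noteq> 0} \<subseteq> I"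
    by (auto simp: I_def)
  then show ?thesis
    by (simp add: * distrib_left sum.distrib)
qed

lemma finite_weighted_degree_le: "finite {\<nu> \<in> nonneg_multi_indices. weighted_degree \<nu> \<le> m}"
proof (rule finite_subset)
  show "finite {\<nu>. \<forall>j. (j \<in> {..nat m} \<longrightarrow> \<nu> j \<in> {0..m}) \<and> (j \<notin> {..nat m} \<longrightarrow> \<nu> j = 0)}"
    by (intro finite_set_of_finite_funs) auto
  show "{\<nu> \<in> nonneg_multi_indices. weighted_degree \<nu> \<le> m} \<subseteq>
      {\<nu>. \<forall>j. (j \<in> {..nat m} \<longrightarrow> \<nu> j \<in> {0..m}) \<and> (j \<notin> {..nat m} \<longrightarrow> \<nu> j = 0)}"
  proof (intro subsetI CollectI allI)
    fix \<nu> j assume "\<nu> \<in> {\<nu> \<in> nonneg_multi_indices. weighted_degree \<nu> \<le> m}"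
    then have \<nu>: "finite {j. \<nu> j \<noteq> 0}" "\<And>j. \<nu> j \<ge> 0" "weighted_degree \<nu> \<le> m"
      by (auto simp: nonneg_multi_indices_def int_multi_indices_def)
    have le: "(int j + 1) * \<nu> j \<le> m" if "\<nu> j \<noteq> 0"
    proof -
      have "(int j + 1) * \<nu> j \<le> weighted_degree \<nu>"
        unfolding weighted_degree_def using \<nu> that by (intro member_le_sum) auto
      then show ?thesis
        using \<nu>(3) by simp
    qed
    have "\<nu> j = 0 \<or> int j + 1 \<le> m \<and> \<nu> j \<le> m"
    proof (cases "\<nu> j = 0")
      case False
      then have "1 \<le> \<nu> j"
        using \<nu>(2)[of j] by linarith
      then have "int j + 1 \<le> (int j + 1) * \<nu> j" "\<nu> j \<le> (int j + 1) * \<nu> j"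
        using mult_left_mono[of 1 "\<nu> j" "int j + 1"] mult_right_mono[of 1 "int j + 1" "\<nu> j"]
        by simp_all
      then have "int j + 1 \<le> m" "\<nu> j \<le> m"
        using order_trans[OF _ le[OF False]] by blast+
      then show ?thesis
        by simp
    qed simp
    moreover have "0 \<le> weighted_degree \<nu>"
      unfolding weighted_degree_def using \<nu> by (intro sum_nonneg) auto
    ultimately show "(j \<in> {..nat m} \<longrightarrow> \<nu> j \<in> {0..m}) \<and> (j \<notin> {..nat m} \<longrightarrow> \<nu> j = 0)"
      using \<nu>(2)[of j] \<nu>(3) by auto
  qed
qed

section \<open>Trigonometric polynomials with spectrum in a half-space\<close>

text \<open>
  Polynomials are identified with their values on the torus, which is the purpose of the last rule:
  \<open>z\<^sup>\<nu> z\<^sup>\<kappa> = z\<^sup>\<nu>\<^sup>+\<^sup>\<kappa>\<close> may fail where a coordinate is zero.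
\<close>

inductive_set trig_polys :: "(nat \<Rightarrow> int) set \<Rightarrow> ((nat \<Rightarrow> complex) \<Rightarrow> complex) set"
  for P where
  zero: "(\<lambda>_. 0) \<in> trig_polys P"
| monomial: "\<nu> \<in> P \<Longrightarrow> (\<lambda>z. c * torus_monomial \<nu> z) \<in> trig_polys P"
| add: "F \<in> trig_polys P \<Longrightarrow> G \<in> trig_polys P \<Longrightarrow> (\<lambda>z. F z + G z) \<in> trig_polys P"
| cong: "F \<in> trig_polys P \<Longrightarrow> (\<And>z. z \<in> infinite_torus \<Longrightarrow> G z = F z) \<Longrightarrow> G \<in> trig_polys P"

lemma trig_polys_scale:
  assumes "F \<in> trig_polys P"
  shows "(\<lambda>z. c * F z) \<in> trig_polys P"
  using assms
proof induction
  case (monomial \<nu> d)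
  then show ?case
    using trig_polys.monomial[of \<nu> P "c * d"] by (simp add: mult.assoc)
next
  case (add F G)
  then show ?case
    using trig_polys.add by (fastforce simp: distrib_left)
next
  case (cong F G)
  then show ?case
    by (auto intro: trig_polys.cong[where F="\<lambda>z. c * F z"])
qed (simp add: trig_polys.zero)

lemma trig_polys_mult:
  assumes P: "half_space P" and F: "F \<in> trig_polys P" and G: "G \<in> trig_polys P"
  shows "(\<lambda>z. F z * G z) \<in> trig_polys P"
  using F
proof induction
  case (monomial \<nu> c)
  show ?case
    using G
  proof induction
    case (monomial \<kappa> d)
    have "\<nu> \<in> int_multi_indices" "\<kappa> \<in> int_multi_indices" "(\<lambda>j. \<nu> j + \<kappa> j) \<in> P"
      using P \<open>\<nu> \<in> P\<close> \<open>\<kappa> \<in> P\<close> by (auto simp: half_space_def)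
    then show ?case
      by (intro trig_polys.cong[OF trig_polys.monomial[of "\<lambda>j. \<nu> j + \<kappa> j" P "c * d"]])
        (simp_all flip: torus_monomial_mult)
  next
    case (add G H)
    from trig_polys.add[OF add.IH] show ?case
      by (simp add: distrib_left)
  next
    case (cong G H)
    then show ?case
      by (auto intro: trig_polys.cong[where F="\<lambda>z. c * torus_monomial \<nu> z * G z"])
  qed (simp add: trig_polys.zero)
next
  case (add F H)
  from trig_polys.add[OF add.IH] show ?case
    by (simp add: distrib_right)
next
  case (cong F H)
  then show ?case
    by (auto intro: trig_polys.cong[where F="\<lambda>z. F z * G z"])
qed (simp add: trig_polys.zero)

lemma trig_polys_power:
  assumes "half_space P" "F \<in> trig_polys P"
  shows "(\<lambda>z. F z ^ Suc n) \<in> trig_polys P"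
proof (induction n)
  case (Suc n)
  then show ?case
    using trig_polys_mult[OF assms(1,2) Suc] by simp
qed (simp add: assms(2))

lemma continuous_on_trig_polys: "F \<in> trig_polys P \<Longrightarrow> continuous_on infinite_torus F"
proof (induction rule: trig_polys.induct)
  case (monomial \<nu> c)
  show ?case
    by (intro continuous_intros continuous_on_torus_monomial)
next
  case (add F G)
  then show ?case
    by (intro continuous_intros)
next
  case (cong F G)
  then show ?case
    using continuous_on_cong[of infinite_torus infinite_torus G F] by simp
qed (rule continuous_on_const)

lemma integral_trig_polys_eq_0:
  fixes h :: "(nat \<Rightarrow> complex) \<Rightarrow> complex"
  assumes h: "integrable S h" and s: "sets S = sets torus_borel"
    and P: "\<And>\<nu>. \<nu> \<in> P \<Longrightarrow> (\<integral>z. h z * torus_monomial \<nu> z \<partial>S) = 0"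
    and F: "F \<in> trig_polys P"
  shows "(\<integral>z. h z * F z \<partial>S) = 0"
  using F
proof induction
  case (monomial \<nu> c)
  have "(\<integral>z. h z * (c * torus_monomial \<nu> z) \<partial>S) = c * (\<integral>z. h z * torus_monomial \<nu> z \<partial>S)"
    by (simp add: mult.left_commute)
  then show ?case
    using P[OF monomial] by simp
next
  case (add F G)
  then show ?case
    using h s by (simp add: distrib_left integrable_mult_continuous continuous_on_trig_polys)
next
  case (cong F G)
  have "(\<integral>z. h z * G z \<partial>S) = (\<integral>z. h z * F z \<partial>S)"
    using cong.hyps space_torus[OF s] by (intro Bochner_Integration.integral_cong) auto
  then show ?case
    using cong.IH by simp
qed simp

text \<open>
  Since the spectrum of \<open>F\<close> lies in a half-space, so does that of every power \<open>F\<^sup>k\<close> with \<open>k \<ge> 1\<close>. Hence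
  only the constant term of the exponential series contributes to the integral.
\<close>

lemma integral_exp_trig_polys:
  fixes h :: "(nat \<Rightarrow> complex) \<Rightarrow> complex"
  assumes H: "half_space P" and h: "integrable S h" and s: "sets S = sets torus_borel"
    and P: "\<And>\<nu>. \<nu> \<in> P \<Longrightarrow> (\<integral>z. h z * torus_monomial \<nu> z \<partial>S) = 0"
    and F: "F \<in> trig_polys P"
  shows "(\<integral>z. h z * exp (F z) \<partial>S) = (\<integral>z. h z \<partial>S)"
proof -
  have [measurable]: "h \<in> borel_measurable S" "F \<in> borel_measurable S"
    using h borel_measurable_torus_continuous[OF s continuous_on_trig_polys[OF F]] by auto
  obtain B where B: "\<And>z. z \<in> infinite_torus \<Longrightarrow> norm (F z) \<le> B"
    using bounded_on_torus[OF continuous_on_trig_polys[OF F]] by metis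
  define q where "q n z = (\<Sum>k<n. F z ^ Suc k / fact (Suc k))" for n z
  have q: "q n \<in> trig_polys P" for n
  proof (induction n)
    case (Suc n)
    have "(\<lambda>z. q n z + 1 / fact (Suc n) * F z ^ Suc n) \<in> trig_polys P"
      by (intro trig_polys.add Suc trig_polys_scale trig_polys_power[OF H F])
    then show ?case
      by (simp add: q_def[abs_def])
  qed (simp add: q_def[abs_def] trig_polys.zero)
  have one_q: "1 + q n z = (\<Sum>k<Suc n. F z ^ k /\<^sub>R fact k)" for n z
    unfolding q_def sum.lessThan_Suc_shift by (simp add: scaleR_conv_of_real field_simps)
  have "(\<lambda>n. \<integral>z. h z * (1 + q n z) \<partial>S) \<longlonglongrightarrow> (\<integral>z. h z * exp (F z) \<partial>S)"
  proof (rule integral_dominated_convergence)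
    show "integrable S (\<lambda>z. exp B * norm (h z))"
      using h by simp
    show "AE z in S. (\<lambda>n. h z * (1 + q n z)) \<longlonglongrightarrow> h z * exp (F z)"
    proof (intro AE_I2 tendsto_mult_left)
      fix z
      have "(\<lambda>n. \<Sum>k<Suc n. F z ^ k /\<^sub>R fact k) \<longlonglongrightarrow> exp (F z)"
        using exp_converges[of "F z"] unfolding sums_def by (rule LIMSEQ_Suc)
      then show "(\<lambda>n. 1 + q n z) \<longlonglongrightarrow> exp (F z)"
        unfolding one_q .
    qed
    show "AE z in S. norm (h z * (1 + q n z)) \<le> exp B * norm (h z)" for n
    proof (intro AE_I2)
      fix z assume "z \<in> space S"
      then have z: "norm (F z) \<le> B"
        using B s by (simp add: space_torus)
      have "norm (1 + q n z) \<le> (\<Sum>k<Suc n. norm (F z) ^ k /\<^sub>R fact k)"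
        unfolding one_q by (intro order_trans[OF norm_sum]) (simp add: norm_power)
      also have "\<dots> \<le> (\<Sum>k. norm (F z) ^ k /\<^sub>R fact k)"
        by (intro sum_le_suminf sums_summable[OF exp_converges]) auto
      also have "\<dots> = exp (norm (F z))"
        by (rule sums_unique[symmetric, OF exp_converges])
      also have "\<dots> \<le> exp B"
        using z by simp
      finally have "norm (h z) * norm (1 + q n z) \<le> norm (h z) * exp B"
        by (intro mult_left_mono) auto
      then show "norm (h z * (1 + q n z)) \<le> exp B * norm (h z)"
        by (simp add: norm_mult mult.commute)
    qed
  qed (auto simp: q_def)
  moreover have "(\<integral>z. h z * (1 + q n z) \<partial>S) = (\<integral>z. h z \<partial>S)" for n
    using h integral_trig_polys_eq_0[OF h s P q, of n]
      integrable_mult_continuous[OF h s continuous_on_trig_polys[OF q], of n]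
    by (simp add: distrib_left)
  ultimately show ?thesis
    by (simp add: LIMSEQ_const_iff)
qed

text \<open>
  For a half-space \<open>P\<close> these are all real trigonometric polynomials, because a term with spectrum in
  \<open>-P\<close> has the same real part as its conjugate, whose spectrum lies in \<open>P\<close>. This form
  exhibits the analytic polynomial \<open>F\<close> of which \<open>u\<close> is the real part, up to a constant.
\<close>

definition real_trig_polys :: "(nat \<Rightarrow> int) set \<Rightarrow> ((nat \<Rightarrow> complex) \<Rightarrow> real) set" where
  "real_trig_polys P = {u. \<exists>a. \<exists>F\<in>trig_polys P. \<forall>z\<in>infinite_torus. u z = a + Re (F z)}"

lemma real_trig_polys_cong:
  "u \<in> real_trig_polys P \<Longrightarrow> (\<And>z. z \<in> infinite_torus \<Longrightarrow> v z = u z) \<Longrightarrow> v \<in> real_trig_polys P"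
  unfolding real_trig_polys_def by fastforce

lemma real_trig_polys_add:
  assumes "u \<in> real_trig_polys P" "v \<in> real_trig_polys P"
  shows "(\<lambda>z. u z + v z) \<in> real_trig_polys P"
proof -
  obtain a F b G where "F \<in> trig_polys P" "G \<in> trig_polys P"
    "\<forall>z\<in>infinite_torus. u z = a + Re (F z)" "\<forall>z\<in>infinite_torus. v z = b + Re (G z)"
    using assms unfolding real_trig_polys_def by blast
  then show ?thesis
    unfolding real_trig_polys_def
    by (auto intro!: exI[of _ "a + b"] bexI[of _ "\<lambda>z. F z + G z"] trig_polys.add)
qed

lemma Re_trig_polys_in_real_trig_polys: "F \<in> trig_polys P \<Longrightarrow> (\<lambda>z. Re (F z)) \<in> real_trig_polys P"
  unfolding real_trig_polys_def by (auto intro!: exI[of _ 0])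

lemma const_in_real_trig_polys: "(\<lambda>_. a) \<in> real_trig_polys P"
  unfolding real_trig_polys_def using trig_polys.zero by force

lemma Re_monomial_in_real_trig_polys:
  assumes P: "half_space P" and \<nu>: "\<nu> \<in> int_multi_indices"
  shows "(\<lambda>z. Re (c * torus_monomial \<nu> z)) \<in> real_trig_polys P"
proof -
  consider "\<nu> = (\<lambda>_. 0)" | "\<nu> \<in> P" | "(\<lambda>j. - \<nu> j) \<in> P"
    using P \<nu> by (auto simp: half_space_def)
  then show ?thesis
  proof cases
    case 1
    then show ?thesis
      by (simp add: const_in_real_trig_polys)
  next
    case 2
    then show ?thesis
      by (intro Re_trig_polys_in_real_trig_polys trig_polys.monomial)
  next
    case 3
    then have "(\<lambda>z. Re (cnj c * torus_monomial (\<lambda>j. - \<nu> j) z)) \<in> real_trig_polys P"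
      by (intro Re_trig_polys_in_real_trig_polys trig_polys.monomial)
    then show ?thesis
      by (rule real_trig_polys_cong) (simp flip: cnj_torus_monomial)
  qed
qed

text \<open>
  The spectrum of \<open>F cnj G\<close> consists of differences of elements of \<open>P\<close>; each difference is zero or lies in
  \<open>P\<close> or \<open>-P\<close>, where totality of the order enters.
\<close>

lemma Re_mult_cnj_in_real_trig_polys:
  assumes P: "half_space P" and F: "F \<in> trig_polys P" and G: "G \<in> trig_polys P"
  shows "(\<lambda>z. Re (F z * cnj (G z))) \<in> real_trig_polys P"
  using F
proof induction
  case (monomial \<nu> c)
  show ?case
    using G
  proof induction
    case (monomial \<kappa> d)
    have i: "\<nu> \<in> int_multi_indices" "\<kappa> \<in> int_multi_indices"
      using P \<open>\<nu> \<in> P\<close> \<open>\<kappa> \<in> P\<close> by (auto simp: half_space_def)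
    then have i': "(\<lambda>j. - \<kappa> j) \<in> int_multi_indices"
      by (simp add: multi_index_uminus)
    show ?case
    proof (rule real_trig_polys_cong)
      show "(\<lambda>z. Re (c * cnj d * torus_monomial (\<lambda>j. \<nu> j + - \<kappa> j) z)) \<in> real_trig_polys P"
        by (intro Re_monomial_in_real_trig_polys P multi_index_add i i')
      show "Re (c * torus_monomial \<nu> z * cnj (d * torus_monomial \<kappa> z)) =
          Re (c * cnj d * torus_monomial (\<lambda>j. \<nu> j + - \<kappa> j) z)" if "z \<in> infinite_torus" for z
        unfolding torus_monomial_mult[OF i(1) i' that, symmetric] cnj_torus_monomial[OF that, symmetric]
        by (simp add: mult_ac)
    qed
  next
    case (add G H)
    from real_trig_polys_add[OF add.IH] show ?case
      by (rule real_trig_polys_cong) (simp add: algebra_simps)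
  next
    case (cong G H)
    then show ?case
      by (auto intro: real_trig_polys_cong[OF cong.IH])
  qed (simp add: const_in_real_trig_polys)
next
  case (add F H)
  from real_trig_polys_add[OF add.IH] show ?case
    by (rule real_trig_polys_cong) (simp add: algebra_simps)
next
  case (cong F H)
  then show ?case
    by (auto intro: real_trig_polys_cong[OF cong.IH])
qed (simp add: const_in_real_trig_polys)

text \<open>
  This rests on \<open>Re x Re y = Re (x y / 2) + Re (x cnj y / 2)\<close>.
\<close>

lemma real_trig_polys_mult:
  assumes P: "half_space P" and "u \<in> real_trig_polys P" "v \<in> real_trig_polys P"
  shows "(\<lambda>z. u z * v z) \<in> real_trig_polys P"
proof -
  obtain a F b G where FG: "F \<in> trig_polys P" "G \<in> trig_polys P"
    and uv: "\<And>z. z \<in> infinite_torus \<Longrightarrow> u z = a + Re (F z)"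
      "\<And>z. z \<in> infinite_torus \<Longrightarrow> v z = b + Re (G z)"
    using assms unfolding real_trig_polys_def by blast
  have half: "(\<lambda>z. 1/2 * F z) \<in> trig_polys P"
    by (intro trig_polys_scale FG)
  have "(\<lambda>z. a * b + Re (a * G z + b * F z) + Re (1/2 * F z * G z) + Re (1/2 * F z * cnj (G z)))
      \<in> real_trig_polys P"
    by (intro real_trig_polys_add const_in_real_trig_polys Re_trig_polys_in_real_trig_polys trig_polys.add
        trig_polys_scale trig_polys_mult[OF P half] Re_mult_cnj_in_real_trig_polys[OF P half] FG)
  then show ?thesis
  proof (rule real_trig_polys_cong)
    have polar: "Re x * Re y = Re (1/2 * x * y) + Re (1/2 * x * cnj y)" for x y
      by (simp add: field_simps)
    show "u z * v z = a * b + Re (a * G z + b * F z) + Re (1/2 * F z * G z) +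
        Re (1/2 * F z * cnj (G z))" if "z \<in> infinite_torus" for z
    proof -
      have "u z * v z = a * b + (a * Re (G z) + b * Re (F z)) + Re (F z) * Re (G z)"
        unfolding uv(1)[OF that] uv(2)[OF that] by (simp only: ring_distribs ac_simps)
      then show ?thesis
        unfolding polar[of "F z" "G z"] by simp
    qed
  qed
qed

text \<open>
  These are the hypotheses of the Stone-Weierstrass theorem, so real trigonometric polynomials are
  uniformly dense in the continuous real functions on the torus.
\<close>

lemma function_ring_on_real_trig_polys:
  assumes P: "half_space P"
  shows "function_ring_on (real_trig_polys P) infinite_torus"
proof
  show "compact infinite_torus"
    by (rule compact_infinite_torus)
  show "continuous_on infinite_torus u" if u: "u \<in> real_trig_polys P" for u
  proof -
    obtain a F where F: "F \<in> trig_polys P" and u: "\<And>z. z \<in> infinite_torus \<Longrightarrow> u z = a + Re (F z)"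
      using u by (auto simp: real_trig_polys_def)
    have "continuous_on infinite_torus (\<lambda>z. a + Re (F z))"
      by (rule continuous_on_add[OF continuous_on_const continuous_on_Re[OF continuous_on_trig_polys[OF F]]])
    then show ?thesis
      by (rule continuous_on_eq) (rule u[symmetric])
  qed
  show "\<exists>u\<in>real_trig_polys P. u x \<noteq> u y"
    if xy: "x \<in> infinite_torus" "y \<in> infinite_torus" "x \<noteq> y" for x y
  proof -
    obtain j where j: "x j \<noteq> y j"
      using xy(3) by (auto simp: fun_eq_iff)
    define e where "e = (\<lambda>i. if i = j then 1 else 0 :: int)"
    have supp: "{i. e i \<noteq> 0} = {j}"
      by (auto simp: e_def)
    have e: "e \<in> int_multi_indices"
      by (simp add: supp int_multi_indices_def)
    have "torus_monomial e z = z j" for z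
      unfolding torus_monomial_def supp by (simp add: e_def)
    then have "(\<lambda>z. Re (c * z j)) \<in> real_trig_polys P" for c
      using Re_monomial_in_real_trig_polys[OF P e, of c] by simp
    from this[of 1] this[of "- \<i>"] have
      "(\<lambda>z. Re (z j)) \<in> real_trig_polys P" "(\<lambda>z. Im (z j)) \<in> real_trig_polys P"
      by simp_all
    note this[THEN bexI[where P="\<lambda>u. u x \<noteq> u y", rotated]]
    moreover have "Re (x j) \<noteq> Re (y j) \<or> Im (x j) \<noteq> Im (y j)"
      using j by (simp add: complex_eq_iff)
    ultimately show ?thesis
      by (elim disjE)
  qed
next
  show "(\<lambda>x. f x + g x) \<in> real_trig_polys P" "(\<lambda>x. f x * g x) \<in> real_trig_polys P"
    if "f \<in> real_trig_polys P" "g \<in> real_trig_polys P" for f g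
    using real_trig_polys_add[OF that] real_trig_polys_mult[OF P that] .
  show "(\<lambda>_. c) \<in> real_trig_polys P" for c
    by (rule const_in_real_trig_polys)
qed

section \<open>Continuous approximation of closed sets\<close>

text \<open>
  Continuous functions decreasing to the indicator of a closed non-empty set. For empty \<open>K\<close> the value is
  constantly 1, since the distance to the empty set is 0 by convention.
\<close>

definition bump :: "'a::metric_space set \<Rightarrow> nat \<Rightarrow> 'a \<Rightarrow> real" where
  "bump K n z = max 0 (1 - real n * infdist z K)"

lemma continuous_on_bump: "continuous_on A (bump K n)"
  unfolding bump_def by (intro continuous_intros)

lemma bump_bounds: "0 \<le> bump K n z" "bump K n z \<le> 1"
  by (simp_all add: bump_def infdist_nonneg)

lemma bump_eq_1: "z \<in> K \<Longrightarrow> bump K n z = 1"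
  by (simp add: bump_def)

lemma bump_tendsto_indicator:
  assumes "closed K" "K \<noteq> {}"
  shows "(\<lambda>n. bump K n z) \<longlonglongrightarrow> indicator K z"
proof (cases "z \<in> K")
  case True
  then show ?thesis
    by (simp add: bump_eq_1)
next
  case False
  then have d: "infdist z K > 0"
    using assms by (intro infdist_pos_not_in_closed)
  obtain m :: nat where "1 / infdist z K < m"
    using reals_Archimedean2 by blast
  then have m: "1 < m * infdist z K"
    using d by (simp add: field_simps)
  have "bump K n z = 0" if "n \<ge> m" for n
  proof -
    have "m * infdist z K \<le> n * infdist z K"
      using that d by (intro mult_right_mono) auto
    then show ?thesis
      using m by (simp add: bump_def)
  qed
  then have "eventually (\<lambda>n. bump K n z = indicator K z) sequentially"
    using False by (auto simp: eventually_sequentially)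
  then show ?thesis
    by (rule tendsto_eventually)
qed

text \<open>
  Inner regularity provides closed subsets of \<open>E\<close> whose complements in \<open>E\<close> have arbitrarily small
  measure; finite unions make the sequence increasing, so that a point of the union lies in almost all
  its members.
\<close>

lemma closed_exhaustion:
  assumes "finite_measure S" and s: "sets S = sets torus_borel" and E: "E \<in> sets torus_borel"
  obtains K :: "nat \<Rightarrow> (nat \<Rightarrow> complex) set" where "incseq K" "\<And>n. closed (K n)" "\<And>n. K n \<subseteq> E"
    "E - (\<Union>n. K n) \<in> null_sets S"
proof -
  interpret S: finite_measure S by fact
  have [simp]: "space S = infinite_torus"
    by (rule space_torus[OF s])
  have closedT: "closed infinite_torus"
    by (rule compact_imp_closed[OF compact_infinite_torus])
  have sT: "B \<in> sets torus_borel \<longleftrightarrow> B \<in> sets borel \<and> B \<subseteq> infinite_torus" for B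
    using closedT by (auto simp: torus_borel_def sets_restrict_space_iff)
  have id: "(\<lambda>z. z) \<in> measurable S borel"
    unfolding measurable_cong_sets[OF s refl] torus_borel_def
    by (intro measurable_restrict_space1) simp
  \<comment> \<open>Finite Borel measures on a Polish space are regular; to use this, \<open>S\<close> is extended by zero to
    all sequences.\<close>
  define S' where "S' = distr S borel (\<lambda>z. z)"
  have S': "emeasure S' B = emeasure S B" if "B \<in> sets torus_borel" for B
    using that sT by (simp add: S'_def emeasure_distr[OF id] Int_absorb2)
  have "finite_measure S'"
    unfolding S'_def by (rule S.finite_measure_distr[OF id])
  then have fin: "emeasure S' (space S') \<noteq> \<infinity>"
    by (simp add: finite_measure.emeasure_finite)
  have reg: "emeasure S' E = (SUP K\<in>{K. K \<subseteq> E \<and> compact K}. emeasure S' K)"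
    by (rule inner_regular) (use fin E sT in \<open>auto simp: S'_def\<close>)
  have cK: "K \<in> sets torus_borel" if "K \<subseteq> E" "closed K" for K
    using that E by (auto simp: sT)
  have "\<exists>K. K \<subseteq> E \<and> closed K \<and> measure S (E - K) \<le> 1 / Suc n" for n
  proof (cases "measure S E \<le> 1 / Suc n")
    case True
    then show ?thesis
      by (intro exI[of _ "{}"]) auto
  next
    case False
    then have pos: "0 < measure S E"
      by (meson divide_pos_pos less_le_trans linear of_nat_0_less_iff zero_less_Suc zero_less_one)
    have "ennreal (measure S E - 1 / Suc n) < emeasure S' E"
      unfolding S'[OF E] S.emeasure_eq_measure using pos by (intro ennreal_lessI) auto
    then obtain K where K: "K \<subseteq> E" "compact K" "ennreal (measure S E - 1 / Suc n) < emeasure S' K"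
      unfolding reg less_SUP_iff by blast
    have sK: "K \<in> sets torus_borel"
      using K by (intro cK compact_imp_closed)
    have "measure S E - 1 / Suc n < measure S K"
      using K(3) ennreal_less_iff[of "measure S E - 1 / Suc n" "measure S K"] False
      unfolding S'[OF sK] S.emeasure_eq_measure by simp
    moreover have "measure S (E - K) = measure S E - measure S K"
      using sK E K(1) s by (intro S.finite_measure_Diff) auto
    ultimately show ?thesis
      using K by (intro exI[of _ K]) (auto intro: compact_imp_closed)
  qed
  then obtain L where L: "\<And>n::nat. L n \<subseteq> E" "\<And>n. closed (L n)" "\<And>n. measure S (E - L n) \<le> 1 / Suc n"
    by metis
  define K where "K n = (\<Union>i\<le>n. L i)" for n
  show thesis
  proof (rule that[of K])
    show "incseq K"
      unfolding K_def by (intro monoI UN_mono) auto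
    show closedK: "closed (K n)" for n
      using L by (auto simp: K_def)
    show KE: "K n \<subseteq> E" for n
      using L by (auto simp: K_def)
    have m: "E - (\<Union>n. K n) \<in> sets S"
      using cK[OF KE closedK] E s by auto
    have "measure S (E - (\<Union>n. K n)) \<le> 1 / Suc n" for n
    proof -
      have "measure S (E - (\<Union>n. K n)) \<le> measure S (E - L n)"
        using m cK[OF L(1,2)] E s by (intro S.finite_measure_mono) (auto simp: K_def)
      then show ?thesis
        using L(3)[of n] by linarith
    qed
    moreover have "(\<lambda>n. 1 / real (Suc n)) \<longlonglongrightarrow> 0"
      using LIMSEQ_inverse_real_of_nat by (simp add: inverse_eq_divide)
    ultimately have "measure S (E - (\<Union>n. K n)) \<le> 0"
      by (intro LIMSEQ_le_const[of "\<lambda>n. 1 / real (Suc n)"]) auto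
    then have "measure S (E - (\<Union>n. K n)) = 0"
      using measure_nonneg by (rule antisym)
    then show "E - (\<Union>n. K n) \<in> null_sets S"
      using m by (simp add: null_sets_def S.emeasure_eq_measure)
  qed
qed

section \<open>The singular part of a measure with spectrum in a half-space\<close>

text \<open>
  A large multiple of a narrow bump around \<open>K\<close> has small Haar mean, because \<open>K\<close> is a null set. A real
  trigonometric polynomial \<open>u = a + Re F\<close> close to it has constant term \<open>a\<close> equal to its mean, hence
  small, so that \<open>- F\<close> is the required function.
\<close>

lemma trig_polys_peaking_on_null_set:
  assumes P: "half_space P" and K: "closed K" "K \<in> null_sets torus_haar" and \<epsilon>: "\<epsilon> > 0"
  obtains F where "F \<in> trig_polys P" "\<And>z. z \<in> infinite_torus \<Longrightarrow> Re (F z) \<le> \<epsilon>"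
    "\<And>z. z \<in> K \<Longrightarrow> Re (F z) \<le> - C"
proof (cases "K = {}")
  case True
  then show thesis
    using that[OF trig_polys.zero] \<epsilon> by simp
next
  case False
  interpret haar: prob_space torus_haar
    by (rule prob_space_torus_haar)
  note s = sets_torus_haar
  have KT: "K \<subseteq> infinite_torus"
    using K(2) sets.sets_into_space space_torus_haar by blast
  \<comment> \<open>The height of the bump; the summand \<open>\<epsilon>\<close> pays for the two later errors, the uniform
    approximation (\<open>\<epsilon> / 3\<close>) and the constant term (\<open>2 \<epsilon> / 3\<close>).\<close>
  define D where "D = \<bar>C\<bar> + \<epsilon>"
  have meas [measurable]: "bump K n \<in> borel_measurable torus_haar" for n
    by (rule borel_measurable_torus_continuous[OF s continuous_on_bump])
  have "(\<lambda>n. \<integral>z. D * bump K n z \<partial>torus_haar) \<longlonglongrightarrow> (\<integral>z. D * indicator K z \<partial>torus_haar)"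
  proof (rule integral_dominated_convergence[where w="\<lambda>_. \<bar>D\<bar>"])
    show "AE z in torus_haar. (\<lambda>n. D * bump K n z) \<longlonglongrightarrow> D * indicator K z"
      by (intro AE_I2 tendsto_mult_left bump_tendsto_indicator K False)
    show "AE z in torus_haar. norm (D * bump K n z) \<le> \<bar>D\<bar>" for n
      using bump_bounds[of K n] by (simp add: abs_mult mult_left_le)
  qed (use K in auto)
  moreover have "(\<integral>z. D * indicator K z \<partial>torus_haar) = 0"
    using K(2) by (simp add: measure_eq_0_null_sets)
  ultimately have "eventually (\<lambda>n. (\<integral>z. D * bump K n z \<partial>torus_haar) < \<epsilon> / 3) sequentially"
    using \<epsilon> by (intro order_tendstoD(2)[where a="\<epsilon> / 3"]) auto
  then obtain n where n: "(\<integral>z. D * bump K n z \<partial>torus_haar) < \<epsilon> / 3"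
    by (auto simp: eventually_sequentially)
  interpret ring: function_ring_on "real_trig_polys P" infinite_torus
    by (rule function_ring_on_real_trig_polys[OF P])
  have "continuous_on infinite_torus (\<lambda>z. D * bump K n z)"
    by (intro continuous_intros continuous_on_bump)
  from ring.Stone_Weierstrass_basic[OF this, of "\<epsilon> / 3"] \<epsilon> obtain u
    where u: "u \<in> real_trig_polys P"
      "\<And>z. z \<in> infinite_torus \<Longrightarrow> \<bar>D * bump K n z - u z\<bar> < \<epsilon> / 3"
    by auto
  obtain a F where F: "F \<in> trig_polys P" and uF: "\<And>z. z \<in> infinite_torus \<Longrightarrow> u z = a + Re (F z)"
    using u(1) by (auto simp: real_trig_polys_def)
  have "(\<integral>z. 1 * torus_monomial \<nu> z \<partial>torus_haar) = 0" if "\<nu> \<in> P" for \<nu>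
    using that P integral_torus_haar_monomial[of \<nu>] by (auto simp: half_space_def)
  from integral_trig_polys_eq_0[OF _ s this F] have F0: "(\<integral>z. F z \<partial>torus_haar) = 0"
    by simp
  have intF: "integrable torus_haar F"
    using integrable_mult_continuous[of torus_haar "\<lambda>_. 1", OF _ s continuous_on_trig_polys[OF F]] by simp
  have intb: "integrable torus_haar (\<lambda>z. D * bump K n z)"
    using bump_bounds[of K n]
    by (intro integrable_mult_right haar.integrable_const_bound[of _ 1]) auto
  have "a = (\<integral>z. a + Re (F z) \<partial>torus_haar)"
    using intF F0 by (simp add: haar.prob_space)
  also have "\<dots> \<le> (\<integral>z. D * bump K n z + \<epsilon> / 3 \<partial>torus_haar)"
  proof (rule integral_mono)
    show "a + Re (F z) \<le> D * bump K n z + \<epsilon> / 3" if "z \<in> space torus_haar" for z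
      using u(2)[of z] uF[of z] that unfolding space_torus_haar by linarith
  qed (use intF intb in auto)
  also have "\<dots> < 2 * \<epsilon> / 3"
    using intb n by (simp add: haar.prob_space)
  finally have a: "a < 2 * \<epsilon> / 3" .
  have le: "- Re (F z) \<le> \<epsilon> - D * bump K n z" if "z \<in> infinite_torus" for z
    using u(2)[OF that] uF[OF that] a by linarith
  show thesis
  proof (rule that[of "\<lambda>z. (-1) * F z"])
    show "(\<lambda>z. (-1) * F z) \<in> trig_polys P"
      by (intro trig_polys_scale F)
    have "0 \<le> D * bump K n z" for z
      using bump_bounds(1)[of K n z] \<epsilon> by (simp add: D_def)
    then show "Re ((-1) * F z) \<le> \<epsilon>" if "z \<in> infinite_torus" for z
      using le[OF that] by (simp add: order_trans[OF le[OF that]])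
    show "Re ((-1) * F z) \<le> - C" if "z \<in> K" for z
      using le[of z] that KT by (auto simp: bump_eq_1 D_def)
  qed
qed

text \<open>
  The F. and M. Riesz theorem for a half-space: the singular part of a measure with spectrum on one side
  of \<open>0\<close> has mean zero. The functions \<open>g n = exp (F n)\<close> leave the integral of \<open>h\<close> unchanged, but
  along a subsequence they converge almost everywhere to the indicator of the complement of \<open>E\<close>.
\<close>

lemma integral_singular_part_eq_0:
  fixes h :: "(nat \<Rightarrow> complex) \<Rightarrow> complex"
  assumes P: "half_space P" and S: "finite_measure S" and s: "sets S = sets torus_borel"
    and E: "E \<in> null_sets torus_haar"
    and largest: "\<And>N. N \<in> null_sets torus_haar \<Longrightarrow> N - E \<in> null_sets S"
    and h: "integrable S h"
    and ann: "\<And>\<nu>. \<nu> \<in> P \<Longrightarrow> (\<integral>z. h z * torus_monomial \<nu> z \<partial>S) = 0"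
  shows "(\<integral>z. h z * indicator E z \<partial>S) = 0"
proof -
  interpret haar: prob_space torus_haar
    by (rule prob_space_torus_haar)
  have spS: "space S = infinite_torus"
    by (rule space_torus[OF s])
  have Eb: "E \<in> sets torus_borel"
    using E sets_torus_haar by auto
  obtain K where K: "incseq K" "\<And>n. closed (K n)" "\<And>n. K n \<subseteq> E" "E - (\<Union>n. K n) \<in> null_sets S"
    using closed_exhaustion[OF S s Eb] by metis
  have Knull: "K n \<in> null_sets torus_haar" for n
  proof (rule null_sets_subset[OF E _ K(3)])
    have "closed infinite_torus"
      by (rule compact_imp_closed[OF compact_infinite_torus])
    moreover have "K n \<subseteq> infinite_torus"
      using K(3)[of n] sets.sets_into_space[OF Eb] space_torus_borel by auto
    ultimately show "K n \<in> sets torus_haar"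
      using K(2)[of n] by (auto simp: sets_torus_haar torus_borel_def sets_restrict_space_iff)
  qed
  have "\<exists>F. F \<in> trig_polys P \<and> (\<forall>z\<in>infinite_torus. Re (F z) \<le> 1 / Suc n) \<and> (\<forall>z\<in>K n. Re (F z) \<le> - real n)"
    for n
  proof -
    have "0 < 1 / real (Suc n)"
      by simp
    from trig_polys_peaking_on_null_set[OF P K(2) Knull this, of n "real n"] show ?thesis
      by metis
  qed
  then obtain F where F: "\<And>n. F n \<in> trig_polys P"
    "\<And>n z. z \<in> infinite_torus \<Longrightarrow> Re (F n z) \<le> 1 / Suc n"
    "\<And>n z. z \<in> K n \<Longrightarrow> Re (F n z) \<le> - real n"
    by metis
  define g where "g n z = exp (F n z)" for n z
  have cg: "continuous_on infinite_torus (g n)" for n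
    unfolding g_def using continuous_on_trig_polys[OF F(1)] by (intro continuous_intros)
  note mg = borel_measurable_torus_continuous[OF _ cg]
  have [measurable]: "g n \<in> borel_measurable torus_haar" "g n \<in> borel_measurable S" for n
    by (rule mg sets_torus_haar s)+
  have g_le: "norm (g n z) \<le> exp (1 / Suc n)" if "z \<in> infinite_torus" for n z
    using F(2)[OF that, of n] by (simp add: g_def)
  have g_le1: "norm (g n z) \<le> exp 1" if "z \<in> infinite_torus" for n z
    by (rule order_trans[OF g_le[OF that]]) (simp add: divide_le_eq)
  have int_g: "integrable torus_haar (g n)" for n
    using integrable_mult_continuous[of torus_haar "\<lambda>_. 1", OF _ sets_torus_haar cg] by simp

  have haar0: "(\<integral>z. 1 * torus_monomial \<nu> z \<partial>torus_haar) = 0" if "\<nu> \<in> P" for \<nu>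
    using that P integral_torus_haar_monomial[of \<nu>] by (auto simp: half_space_def)
  have mean_g: "(\<integral>z. g n z \<partial>torus_haar) = 1" for n
    using integral_exp_trig_polys[OF P _ sets_torus_haar haar0 F(1)[of n]] haar.prob_space
    by (simp add: g_def)

  \<comment> \<open>Mean 1 and modulus at most \<open>exp (1 / (n + 1))\<close> force \<open>g n\<close> to converge to 1 in the mean square.\<close>
  define u where "u n z = (cmod (g n z - 1))\<^sup>2" for n z
  have u_eq: "u n z = (cmod (g n z))\<^sup>2 - 2 * Re (g n z) + 1" for n z
    unfolding u_def cmod_power2 by (simp add: power2_eq_square algebra_simps)
  have int_g2: "integrable torus_haar (\<lambda>z. (cmod (g n z))\<^sup>2)" for n
    using g_le1 by (intro haar.integrable_const_bound[of _ "(exp 1)\<^sup>2"] AE_I2)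
      (auto simp: space_torus_haar intro!: power_mono)
  have int_u: "integrable torus_haar (u n)" for n
    unfolding u_eq[abs_def] using int_g int_g2
    by (intro Bochner_Integration.integrable_add Bochner_Integration.integrable_diff
        integrable_mult_right integrable_Re) auto
  have u_le: "(\<integral>z. u n z \<partial>torus_haar) \<le> (exp (1 / Suc n))\<^sup>2 - 1" for n
  proof -
    have "(\<integral>z. u n z \<partial>torus_haar) = (\<integral>z. (cmod (g n z))\<^sup>2 \<partial>torus_haar) - 1"
      unfolding u_eq using int_g int_g2 mean_g[of n]
      by (simp add: haar.prob_space integral_Re)
    also have "(\<integral>z. (cmod (g n z))\<^sup>2 \<partial>torus_haar) \<le> (\<integral>z. (exp (1 / Suc n))\<^sup>2 \<partial>torus_haar)"
      using int_g2 g_le by (intro integral_mono) (auto simp: space_torus_haar intro!: power_mono)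
    finally show ?thesis
      by (simp add: haar.prob_space)
  qed
  have "(\<lambda>n. (\<integral>z. norm (u n z) \<partial>torus_haar)) \<longlonglongrightarrow> 0"
  proof (rule tendsto_sandwich[OF always_eventually always_eventually tendsto_const])
    show "\<forall>n. 0 \<le> (\<integral>z. norm (u n z) \<partial>torus_haar)"
      by simp
    show "\<forall>n. (\<integral>z. norm (u n z) \<partial>torus_haar) \<le> (exp (1 / Suc n))\<^sup>2 - 1"
      using u_le by (simp add: u_def)
    have "(\<lambda>n. (exp (inverse (real (Suc n))))\<^sup>2 - 1) \<longlonglongrightarrow> (exp 0)\<^sup>2 - 1"
      by (intro tendsto_intros LIMSEQ_inverse_real_of_nat)
    then show "(\<lambda>n. (exp (1 / real (Suc n)))\<^sup>2 - 1) \<longlonglongrightarrow> 0"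
      by (simp add: inverse_eq_divide)
  qed
  from tendsto_L1_AE_subseq[OF int_u this] obtain r :: "nat \<Rightarrow> nat"
    where r: "strict_mono r" "AE z in torus_haar. (\<lambda>n. u (r n) z) \<longlonglongrightarrow> 0"
    by blast
  obtain N where N: "N \<in> null_sets torus_haar"
    "{z \<in> space torus_haar. \<not> (\<lambda>n. u (r n) z) \<longlonglongrightarrow> 0} \<subseteq> N"
    using r(2) unfolding eventually_ae_filter by blast

  \<comment> \<open>The exceptional set of the Haar almost everywhere convergence is harmless outside \<open>E\<close> by the
    maximality of \<open>E\<close>; almost every point of \<open>E\<close> lies in some \<open>K m\<close>, where \<open>g n\<close> is at most
    \<open>exp (- n)\<close> as soon as \<open>n \<ge> m\<close>.\<close>
  have lim: "AE z in S. (\<lambda>n. g (r n) z) \<longlonglongrightarrow> 1 - indicator E z"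
  proof (rule AE_I')
    show "(N - E) \<union> (E - (\<Union>n. K n)) \<in> null_sets S"
      by (intro null_sets.Un largest N K)
    show "{z \<in> space S. \<not> (\<lambda>n. g (r n) z) \<longlonglongrightarrow> 1 - indicator E z} \<subseteq> (N - E) \<union> (E - (\<Union>n. K n))"
    proof (rule subsetI, rule UnCI)
      fix z
      assume "z \<in> {z \<in> space S. \<not> (\<lambda>n. g (r n) z) \<longlonglongrightarrow> 1 - indicator E z}"
      then have z: "z \<in> space S" "\<not> (\<lambda>n. g (r n) z) \<longlonglongrightarrow> 1 - indicator E z"
        by auto
      assume *: "z \<notin> E - (\<Union>n. K n)"
      have zT: "z \<in> infinite_torus"
        using z(1) spS by simp
      have "z \<notin> E"
      proof
        assume "z \<in> E"
        obtain m where m: "z \<in> K m"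
          using * \<open>z \<in> E\<close> by blast
        have "(\<lambda>n. g (r n) z) \<longlonglongrightarrow> 0"
        proof (rule Lim_null_comparison)
          show "eventually (\<lambda>n. norm (g (r n) z) \<le> exp (- real n)) sequentially"
            unfolding eventually_sequentially
          proof (intro exI allI impI)
            fix n assume n: "m \<le> n"
            then have "m \<le> r n" "n \<le> r n"
              using seq_suble[OF r(1), of n] by auto
            then have "Re (F (r n) z) \<le> - real (r n)"
              using F(3) m K(1) by (meson incseqD subsetD)
            then show "norm (g (r n) z) \<le> exp (- real n)"
              using \<open>n \<le> r n\<close> by (simp add: g_def)
          qed
          have "filterlim (\<lambda>n. - real n) at_bot sequentially"
            by (simp add: filterlim_uminus_at_bot filterlim_real_sequentially)
          then show "(\<lambda>n. exp (- real n)) \<longlonglongrightarrow> 0"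
            by (rule filterlim_compose[OF exp_at_bot])
        qed
        then show False
          using z(2) \<open>z \<in> E\<close> by simp
      qed
      moreover have "z \<in> N"
      proof (rule ccontr)
        assume "z \<notin> N"
        then have "(\<lambda>n. u (r n) z) \<longlonglongrightarrow> 0"
          using N(2) zT by (auto simp: space_torus_haar)
        then have "(\<lambda>n. sqrt (u (r n) z)) \<longlonglongrightarrow> sqrt 0"
          by (rule tendsto_real_sqrt)
        then have "(\<lambda>n. g (r n) z - 1) \<longlonglongrightarrow> 0"
          by (simp add: u_def tendsto_norm_zero_iff)
        then have "(\<lambda>n. g (r n) z) \<longlonglongrightarrow> 1"
          by (simp add: LIM_zero_iff)
        then show False
          using z(2) \<open>z \<notin> E\<close> by simp
      qed
      ultimately show "z \<in> N - E"
        by simp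
    qed
  qed

  have [measurable]: "h \<in> borel_measurable S" "E \<in> sets S"
    using h Eb s by auto
  have "(\<lambda>n. \<integral>z. h z * g (r n) z \<partial>S) \<longlonglongrightarrow> (\<integral>z. h z * (1 - indicator E z) \<partial>S)"
  proof (rule integral_dominated_convergence[where w="\<lambda>z. norm (h z) * exp 1"])
    show "AE z in S. (\<lambda>n. h z * g (r n) z) \<longlonglongrightarrow> h z * (1 - indicator E z)"
      using lim by eventually_elim (rule tendsto_mult_left)
    show "AE z in S. norm (h z * g (r n) z) \<le> norm (h z) * exp 1" for n
      using g_le1 spS by (intro AE_I2) (auto simp: norm_mult intro!: mult_left_mono)
  qed (use h in auto)
  moreover have "(\<integral>z. h z * g (r n) z \<partial>S) = (\<integral>z. h z \<partial>S)" for n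
    unfolding g_def by (rule integral_exp_trig_polys[OF P h s ann F(1)])
  ultimately have "(\<integral>z. h z \<partial>S) = (\<integral>z. h z * (1 - indicator E z) \<partial>S)"
    by (simp add: LIMSEQ_const_iff)
  also have "\<dots> = (\<integral>z. h z \<partial>S) - (\<integral>z. h z * indicator E z \<partial>S)"
    using h integrable_mult_bounded[OF h, of "indicator E" 1]
    by (simp add: right_diff_distrib indicator_def)
  finally show ?thesis
    by simp
qed

section \<open>Uniqueness of Fourier coefficients\<close>

text \<open>
  A complex measure whose Fourier coefficients vanish is zero. By Stone-Weierstrass it annihilates all
  continuous functions, by dominated convergence all closed sets, and the closed sets are stable under
  intersection and generate the Borel sets.
\<close>

lemma integral_zero_of_fourier_coefficients_zero:
  fixes h :: "(nat \<Rightarrow> complex) \<Rightarrow> complex"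
  assumes s: "sets S = sets torus_borel" and h: "integrable S h"
    and zero: "\<And>\<nu>. \<nu> \<in> int_multi_indices \<Longrightarrow> (\<integral>z. h z * torus_monomial \<nu> z \<partial>S) = 0"
    and A: "A \<in> sets torus_borel"
  shows "(\<integral>z. h z * indicator A z \<partial>S) = 0"
proof -
  have spS: "space S = infinite_torus"
    by (rule space_torus[OF s])
  \<comment> \<open>Any half-space will do; it serves to write real trigonometric polynomials as real parts.\<close>
  define P where "P = graded_half_space (\<lambda>_. 0)"
  have P: "half_space P"
    unfolding P_def by (rule half_space_graded) simp
  have PZ: "P \<subseteq> int_multi_indices"
    using P by (simp add: half_space_def)
  interpret ring: function_ring_on "real_trig_polys P" infinite_torus
    by (rule function_ring_on_real_trig_polys[OF P])
  have [measurable]: "h \<in> borel_measurable S"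
    using h by simp
  have h0: "(\<integral>z. h z \<partial>S) = 0"
    using zero[of "\<lambda>_. 0"] by (simp add: int_multi_indices_def)
  have cnj0: "(\<integral>z. h z * cnj (F z) \<partial>S) = 0" if F: "F \<in> trig_polys P" for F
    using F
  proof induction
    case (monomial \<nu> c)
    have "(\<integral>z. h z * cnj (c * torus_monomial \<nu> z) \<partial>S) =
        (\<integral>z. cnj c * (h z * torus_monomial (\<lambda>j. - \<nu> j) z) \<partial>S)"
      using spS by (intro Bochner_Integration.integral_cong) (auto simp: cnj_torus_monomial)
    also have "\<dots> = cnj c * (\<integral>z. h z * torus_monomial (\<lambda>j. - \<nu> j) z \<partial>S)"
      by simp
    finally show ?case
      using monomial PZ by (auto simp: zero multi_index_uminus)
  next
    case (add F G)
    then show ?case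
      using h s by (simp add: distrib_left integrable_mult_continuous continuous_on_trig_polys
          continuous_on_cnj)
  next
    case (cong F G)
    have "(\<integral>z. h z * cnj (G z) \<partial>S) = (\<integral>z. h z * cnj (F z) \<partial>S)"
      using cong.hyps spS by (intro Bochner_Integration.integral_cong) auto
    then show ?case
      using cong.IH by simp
  qed simp
  have trig0: "(\<integral>z. h z * of_real (u z) \<partial>S) = 0" if u: "u \<in> real_trig_polys P" for u
  proof -
    obtain a F where F: "F \<in> trig_polys P" and uF: "\<And>z. z \<in> infinite_torus \<Longrightarrow> u z = a + Re (F z)"
      using u by (auto simp: real_trig_polys_def)
    note c = continuous_on_trig_polys[OF F] continuous_on_cnj[OF continuous_on_trig_polys[OF F]]
    have "(\<integral>z. h z * of_real (u z) \<partial>S) =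
        (\<integral>z. of_real a * h z + 1/2 * (h z * F z + h z * cnj (F z)) \<partial>S)"
    proof (intro Bochner_Integration.integral_cong refl)
      fix z assume "z \<in> space S"
      then have "complex_of_real (u z) = of_real a + 1/2 * (F z + cnj (F z))"
        using uF spS by (simp add: complex_add_cnj)
      then show "h z * of_real (u z) = of_real a * h z + 1/2 * (h z * F z + h z * cnj (F z))"
        by (simp add: algebra_simps)
    qed
    also have "\<dots> = of_real a * (\<integral>z. h z \<partial>S) + 1/2 * ((\<integral>z. h z * F z \<partial>S) + (\<integral>z. h z * cnj (F z) \<partial>S))"
      using h integrable_mult_continuous[OF h s c(1)] integrable_mult_continuous[OF h s c(2)]
      by simp
    also have "\<dots> = 0"
      using h0 cnj0[OF F] integral_trig_polys_eq_0[OF h s _ F] zero PZ by auto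
    finally show ?thesis .
  qed
  have cont0: "(\<integral>z. h z * of_real (v z) \<partial>S) = 0" if v: "continuous_on infinite_torus v" for v
  proof -
    have "\<exists>u\<in>real_trig_polys P. \<forall>z\<in>infinite_torus. \<bar>v z - u z\<bar> < 1 / Suc n" for n
      using ring.Stone_Weierstrass_basic[OF v, of "1 / Suc n"] by simp
    then obtain u where u: "\<And>n. u n \<in> real_trig_polys P"
      "\<And>n z. z \<in> infinite_torus \<Longrightarrow> \<bar>v z - u n z\<bar> < 1 / Suc n"
      by metis
    obtain B where B: "\<And>z. z \<in> infinite_torus \<Longrightarrow> norm (v z) \<le> B"
      using bounded_on_torus[OF v] by metis
    have [measurable]: "v \<in> borel_measurable S" "u n \<in> borel_measurable S" for n
      using borel_measurable_torus_continuous[OF s] v ring.continuous[OF u(1)] by auto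
    have "(\<lambda>n. \<integral>z. h z * of_real (u n z) \<partial>S) \<longlonglongrightarrow> (\<integral>z. h z * of_real (v z) \<partial>S)"
    proof (rule integral_dominated_convergence[where w="\<lambda>z. norm (h z) * (B + 1)"])
      show "AE z in S. (\<lambda>n. h z * of_real (u n z)) \<longlonglongrightarrow> h z * of_real (v z)"
      proof (intro AE_I2 tendsto_mult_left tendsto_of_real)
        fix z assume "z \<in> space S"
        then have "\<bar>u n z - v z\<bar> \<le> inverse (real (Suc n))" for n
          using u(2)[of z n] spS by (simp add: inverse_eq_divide abs_minus_commute)
        then have "(\<lambda>n. u n z - v z) \<longlonglongrightarrow> 0"
          by (intro Lim_null_comparison[OF _ LIMSEQ_inverse_real_of_nat]) auto
        then show "(\<lambda>n. u n z) \<longlonglongrightarrow> v z"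
          by (simp add: LIM_zero_iff)
      qed
      show "AE z in S. norm (h z * of_real (u n z)) \<le> norm (h z) * (B + 1)" for n
      proof (intro AE_I2)
        fix z assume "z \<in> space S"
        then have z: "z \<in> infinite_torus"
          using spS by simp
        have "1 / real (Suc n) \<le> 1"
          by (simp add: divide_le_eq)
        then have "\<bar>u n z\<bar> \<le> B + 1"
          using u(2)[OF z, of n] B[OF z] unfolding real_norm_def by linarith
        then show "norm (h z * of_real (u n z)) \<le> norm (h z) * (B + 1)"
          by (simp add: norm_mult mult_left_mono)
      qed
    qed (use h in auto)
    then show ?thesis
      by (simp add: trig0[OF u(1)] LIMSEQ_const_iff)
  qed
  have meas: "integrable S (\<lambda>z. h z * indicator X z)" if X: "X \<in> sets borel" for X
  proof -
    have "{z \<in> space S. z \<in> X} = infinite_torus \<inter> X"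
      using spS by auto
    then have "{z \<in> space S. z \<in> X} \<in> sets S"
      using X s by (auto simp: torus_borel_def sets_restrict_space)
    then have "(indicator X :: _ \<Rightarrow> complex) \<in> borel_measurable S"
      by (rule borel_measurable_indicator')
    then show ?thesis
      using integrable_mult_bounded[OF h, of "indicator X" 1] by (simp add: indicator_def)
  qed
  have closed0: "(\<integral>z. h z * indicator C z \<partial>S) = 0" if C: "closed C" for C
  proof (cases "C = {}")
    case False
    have [measurable]: "bump C n \<in> borel_measurable S" for n
      by (rule borel_measurable_torus_continuous[OF s continuous_on_bump])
    have ind: "indicator C z = complex_of_real (indicator C z)" for z
      by (simp add: indicator_def)
    have [measurable]: "(\<lambda>z. h z * indicator C z) \<in> borel_measurable S"
      using C by (intro borel_measurable_integrable meas) simp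
    have "(\<lambda>n. \<integral>z. h z * of_real (bump C n z) \<partial>S) \<longlonglongrightarrow> (\<integral>z. h z * indicator C z \<partial>S)"
    proof (rule integral_dominated_convergence[where w="\<lambda>z. norm (h z)"])
      show "AE z in S. (\<lambda>n. h z * of_real (bump C n z)) \<longlonglongrightarrow> h z * indicator C z"
        unfolding ind
        by (intro AE_I2 tendsto_mult_left tendsto_of_real bump_tendsto_indicator C False)
      show "AE z in S. norm (h z * of_real (bump C n z)) \<le> norm (h z)" for n
        using bump_bounds[of C n] by (simp add: norm_mult mult_left_le)
    qed (use h in auto)
    then show ?thesis
      by (simp add: cont0[OF continuous_on_bump] LIMSEQ_const_iff)
  qed simp
  obtain B where B: "B \<in> sets borel" "A = B \<inter> infinite_torus"
    using A by (auto simp: torus_borel_def sets_restrict_space)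
  have sb: "sigma_sets UNIV {C :: (nat \<Rightarrow> complex) set. closed C} = sets borel"
    by (simp add: borel_eq_closed)
  have "B \<in> sigma_sets UNIV {C. closed C}"
    using B sb by simp
  then have "(\<integral>z. h z * indicator B z \<partial>S) = 0"
  proof (induction rule: sigma_sets_induct_disjoint[rotated 2, consumes 1, case_names basic empty compl union])
    case (basic C)
    then show ?case
      by (simp add: closed0)
  next
    case empty
    show ?case
      by simp
  next
    case (compl X)
    have X: "X \<in> sets borel"
      using compl.hyps unfolding sb .
    have "(\<integral>z. h z * indicator (UNIV - X) z \<partial>S) = (\<integral>z. h z - h z * indicator X z \<partial>S)"
      by (intro Bochner_Integration.integral_cong) (auto split: split_indicator)
    also have "\<dots> = 0"
      using Bochner_Integration.integral_diff[OF h meas[OF X]] h0 compl.IH by simp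
    finally show ?case .
  next
    case (union X)
    have X: "X i \<in> sets borel" for i
      using range_subsetD[OF union.hyps(2)] unfolding sb .
    have "(\<integral>z. h z * indicator (\<Union>i<n. X i) z \<partial>S) = 0" for n
    proof (induction n)
      case (Suc n)
      have Un: "(\<Union>i<n. X i) \<in> sets borel"
        by (intro sets.finite_UN X) simp
      have "X i \<inter> X n = {}" if "i < n" for i
        using disjoint_family_onD[OF union.hyps(1), of i n] that by simp
      then have "(\<Union>i<n. X i) \<inter> X n = {}"
        by blast
      then have "(\<integral>z. h z * indicator (\<Union>i<Suc n. X i) z \<partial>S) =
          (\<integral>z. h z * indicator (\<Union>i<n. X i) z + h z * indicator (X n) z \<partial>S)"
        by (intro Bochner_Integration.integral_cong refl)
          (auto simp: lessThan_Suc indicator_def)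
      also have "\<dots> = 0"
        unfolding Bochner_Integration.integral_add[OF meas[OF Un] meas[OF X]] Suc.IH union.IH by simp
      finally show ?case .
    qed simp
    moreover have "(\<lambda>n. \<integral>z. h z * indicator (\<Union>i<n. X i) z \<partial>S) \<longlonglongrightarrow>
        (\<integral>z. h z * indicator (\<Union>i. X i) z \<partial>S)"
    proof (rule integral_dominated_convergence[where w="\<lambda>z. norm (h z)"])
      show "AE z in S. (\<lambda>n. h z * indicator (\<Union>i<n. X i) z) \<longlonglongrightarrow> h z * indicator (\<Union>i. X i) z"
        by (intro AE_I2 tendsto_mult_left LIMSEQ_indicator_UN)
      show "AE z in S. norm (h z * indicator (\<Union>i<n. X i) z) \<le> norm (h z)" for n
        by (auto simp: norm_mult split: split_indicator)
      show "integrable S (\<lambda>z. norm (h z))"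
        using h by simp
      show "(\<lambda>z. h z * indicator (\<Union>i<n. X i) z) \<in> borel_measurable S" for n
        by (intro borel_measurable_integrable meas sets.finite_UN X) simp
      show "(\<lambda>z. h z * indicator (\<Union>i. X i) z) \<in> borel_measurable S"
        by (intro borel_measurable_integrable meas sets.countable_UN') (auto intro: X)
    qed
    ultimately show ?case
      by (simp add: LIMSEQ_const_iff)
  qed (auto simp: Int_stable_def)
  moreover have "(\<integral>z. h z * indicator A z \<partial>S) = (\<integral>z. h z * indicator B z \<partial>S)"
    using B(2) spS by (intro Bochner_Integration.integral_cong) (auto split: split_indicator)
  ultimately show ?thesis
    by simp
qed

section \<open>Absolute continuity of analytic measures\<close>

theorem corollary1:
  fixes \<mu> :: "(nat \<Rightarrow> complex) set \<Rightarrow> complex"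
  assumes "analytic_measure \<mu>"
  shows "vector_absolutely_continuous torus_haar \<mu>"
proof -
  have \<mu>: "vector_measure torus_borel \<mu>"
    and ana: "\<And>\<nu>. \<nu> \<in> int_multi_indices - nonneg_multi_indices \<Longrightarrow> fourier_coefficient \<mu> \<nu> = 0"
    using assms by (auto simp: analytic_measure_def)
  obtain S h where S: "finite_measure S" and s: "sets S = sets torus_borel" and h: "integrable S h"
    and rep: "\<forall>f\<in>borel_measurable torus_borel. (\<exists>B. \<forall>z\<in>space torus_borel. norm (f z) \<le> B) \<longrightarrow>
      complex_measure_integral torus_borel \<mu> f = (\<integral>z. h z * f z \<partial>S)"
    by (rule complex_measure_has_density[OF \<mu>])
  have spS: "space S = infinite_torus"
    by (rule space_torus[OF s])
  obtain E where E: "E \<in> null_sets torus_haar"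
    and largest: "\<And>N. N \<in> null_sets torus_haar \<Longrightarrow> N - E \<in> null_sets S"
    using exists_largest_null_set[OF S, of torus_haar] s sets_torus_haar by metis
  have Eb: "E \<in> sets torus_borel"
    using E sets_torus_haar by auto
  have ind: "integrable S (\<lambda>z. k z * indicator A z)"
    if "integrable S k" "A \<in> sets torus_borel" for A and k :: "_ \<Rightarrow> complex"
    using that s by (intro integrable_mult_bounded[of _ _ _ 1]) (auto simp: indicator_def)
  have shift: "(\<integral>z. (k z * torus_monomial \<kappa> z) * torus_monomial \<nu> z \<partial>S) =
      (\<integral>z. k z * torus_monomial (\<lambda>j. \<kappa> j + \<nu> j) z \<partial>S)"
    if "\<kappa> \<in> int_multi_indices" "\<nu> \<in> int_multi_indices" for k \<kappa> \<nu>
    using spS that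
    by (intro Bochner_Integration.integral_cong) (auto simp: torus_monomial_mult[symmetric])
  note mono_int = integrable_mult_continuous[OF _ s continuous_on_torus_monomial]

  have h_coeff: "(\<integral>z. h z * torus_monomial \<kappa> z \<partial>S) = 0"
    if "\<kappa> \<in> int_multi_indices" "\<kappa> j > 0" for \<kappa> j
  proof -
    have "(\<lambda>j. - \<kappa> j) \<in> int_multi_indices - nonneg_multi_indices"
      using that by (auto simp: multi_index_uminus nonneg_multi_indices_def intro!: exI[of _ j])
    then have "complex_measure_integral torus_borel \<mu> (torus_monomial \<kappa>) = 0"
      using ana[of "\<lambda>j. - \<kappa> j"] by (simp add: fourier_coefficient_def)
    then show ?thesis
      using bspec[OF rep, of "torus_monomial \<kappa>"]
        borel_measurable_torus_continuous[OF refl continuous_on_torus_monomial]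
      by (auto simp: norm_torus_monomial space_torus_borel)
  qed

  define hE where "hE z = h z * indicator E z" for z
  have hE: "integrable S hE"
    unfolding hE_def by (intro ind h Eb)

  \<comment> \<open>The singular part \<open>hE\<close> is analytic: if \<open>\<kappa> j > 0\<close>, then \<open>(\<kappa> + \<nu>) j > 0\<close> for every \<open>\<nu>\<close> that is
    positive in an order looking at the \<open>j\<close>-th entry first. The sign is opposite to that of the Fourier
    coefficients, which integrate \<open>z\<^sup>-\<^sup>\<nu>\<close>.\<close>
  have hE_coeff_positive: "(\<integral>z. hE z * torus_monomial \<kappa> z \<partial>S) = 0"
    if \<kappa>: "\<kappa> \<in> int_multi_indices" "\<kappa> j > 0" for \<kappa> j
  proof -
    let ?P = "graded_half_space (\<lambda>\<nu>. \<nu> j)"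
    have P: "half_space ?P"
      by (rule half_space_graded) simp
    have "(\<integral>z. (h z * torus_monomial \<kappa> z) * torus_monomial \<nu> z \<partial>S) = 0" if "\<nu> \<in> ?P" for \<nu>
    proof -
      have \<nu>: "\<nu> \<in> int_multi_indices" "\<nu> j \<ge> 0"
        using that by (auto simp: graded_half_space_def)
      show ?thesis
        unfolding shift[OF \<kappa>(1) \<nu>(1)]
        using \<kappa> \<nu> by (intro h_coeff[of _ j] multi_index_add) auto
    qed
    from integral_singular_part_eq_0[OF P S s E largest mono_int[OF h] this]
    show ?thesis
      by (simp add: hE_def mult_ac)
  qed

  let ?P = "graded_half_space weighted_degree"
  have P: "half_space ?P"
    by (intro half_space_graded weighted_degree_add)
  \<comment> \<open>The non-negative predecessors of \<open>\<nu>\<close> are finite in number, so induction on their number is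
    induction along the order.\<close>
  define below where "below \<nu> = {\<rho> \<in> nonneg_multi_indices. (\<lambda>j. \<nu> j - \<rho> j) \<in> ?P}" for \<nu>
  have below: "finite (below \<nu>)" if \<nu>: "\<nu> \<in> int_multi_indices" for \<nu>
  proof (rule finite_subset[OF _ finite_weighted_degree_le])
    show "below \<nu> \<subseteq> {\<rho> \<in> nonneg_multi_indices. weighted_degree \<rho> \<le> weighted_degree \<nu>}"
    proof
      fix \<rho> assume "\<rho> \<in> below \<nu>"
      then have \<rho>: "\<rho> \<in> nonneg_multi_indices" "(\<lambda>j. \<nu> j - \<rho> j) \<in> ?P"
        by (auto simp: below_def)
      then have "weighted_degree (\<lambda>j. (\<nu> j - \<rho> j) + \<rho> j) =
          weighted_degree (\<lambda>j. \<nu> j - \<rho> j) + weighted_degree \<rho>"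
        by (intro weighted_degree_add) (auto simp: graded_half_space_def nonneg_multi_indices_def)
      moreover have "0 \<le> weighted_degree (\<lambda>j. \<nu> j - \<rho> j)"
        using \<rho> by (auto simp: graded_half_space_def)
      ultimately show "\<rho> \<in> {\<rho> \<in> nonneg_multi_indices. weighted_degree \<rho> \<le> weighted_degree \<nu>}"
        using \<rho> by simp
    qed
  qed
  have hE_coeff_nonpositive: "(\<integral>z. hE z * torus_monomial (\<lambda>j. - \<nu> j) z \<partial>S) = 0"
    if "\<nu> \<in> nonneg_multi_indices" for \<nu>
    using that
  proof (induction "card (below \<nu>)" arbitrary: \<nu> rule: less_induct)
    case less
    have \<nu>: "\<nu> \<in> int_multi_indices" "(\<lambda>j. - \<nu> j) \<in> int_multi_indices"
      using less.prems by (auto simp: nonneg_multi_indices_def multi_index_uminus)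
    have "(\<integral>z. (hE z * torus_monomial (\<lambda>j. - \<nu> j) z) * torus_monomial \<kappa> z \<partial>S) = 0"
      if \<kappa>: "\<kappa> \<in> ?P" for \<kappa>
    proof -
      have \<kappa>': "\<kappa> \<in> int_multi_indices"
        using \<kappa> by (simp add: graded_half_space_def)
      show ?thesis
        unfolding shift[OF \<nu>(2) \<kappa>']
      proof (cases "\<exists>j. - \<nu> j + \<kappa> j > 0")
        case True
        then obtain j where "- \<nu> j + \<kappa> j > 0"
          by blast
        then show "(\<integral>z. hE z * torus_monomial (\<lambda>j. - \<nu> j + \<kappa> j) z \<partial>S) = 0"
          by (intro hE_coeff_positive[of _ j] multi_index_add \<nu>(2) \<kappa>')
      next
        \<comment> \<open>Here \<open>\<kappa> - \<nu>\<close> has no positive entry, so it is the negative of a predecessor of \<open>\<nu>\<close>.\<close>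
        case False
        define \<rho> where "\<rho> = (\<lambda>j. \<nu> j - \<kappa> j)"
        have "(\<lambda>j. \<nu> j + - \<kappa> j) \<in> int_multi_indices"
          using \<nu>(1) \<kappa>' by (intro multi_index_add) (simp_all add: multi_index_uminus)
        then have \<rho>: "\<rho> \<in> nonneg_multi_indices"
          using False by (auto simp: \<rho>_def nonneg_multi_indices_def not_less)
        have "below \<rho> \<subset> below \<nu>"
        proof (rule psubsetI)
          show "below \<rho> \<subseteq> below \<nu>"
          proof
            fix \<sigma> assume \<sigma>: "\<sigma> \<in> below \<rho>"
            then have "(\<lambda>j. \<kappa> j + (\<rho> j - \<sigma> j)) \<in> ?P"
              using P \<kappa> by (auto simp: below_def half_space_def)
            then show "\<sigma> \<in> below \<nu>"
              using \<sigma> by (simp add: below_def \<rho>_def)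
          qed
          have "\<rho> \<in> below \<nu>"
            using \<rho> \<kappa> by (simp add: below_def) (simp add: \<rho>_def)
          moreover have "\<rho> \<notin> below \<rho>"
            using P by (simp add: below_def half_space_def)
          ultimately show "below \<rho> \<noteq> below \<nu>"
            by blast
        qed
        then have "card (below \<rho>) < card (below \<nu>)"
          by (intro psubset_card_mono below \<nu>(1))
        from less.hyps[OF this \<rho>]
        show "(\<integral>z. hE z * torus_monomial (\<lambda>j. - \<nu> j + \<kappa> j) z \<partial>S) = 0"
          by (simp add: \<rho>_def)
      qed
    qed
    from integral_singular_part_eq_0[OF P S s E largest mono_int[OF hE] this]
    have "(\<integral>z. (hE z * torus_monomial (\<lambda>j. - \<nu> j) z) * indicator E z \<partial>S) = 0" .
    also have "(\<lambda>z. (hE z * torus_monomial (\<lambda>j. - \<nu> j) z) * indicator E z) =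
        (\<lambda>z. hE z * torus_monomial (\<lambda>j. - \<nu> j) z)"
      by (auto simp: hE_def split: split_indicator)
    finally show ?case .
  qed
  have hE_coeff: "(\<integral>z. hE z * torus_monomial \<kappa> z \<partial>S) = 0" if \<kappa>: "\<kappa> \<in> int_multi_indices" for \<kappa>
  proof (cases "\<exists>j. \<kappa> j > 0")
    case True
    then show ?thesis
      using hE_coeff_positive \<kappa> by blast
  next
    case False
    then have "(\<lambda>j. - \<kappa> j) \<in> nonneg_multi_indices"
      using \<kappa> by (auto simp: nonneg_multi_indices_def multi_index_uminus not_less)
    from hE_coeff_nonpositive[OF this] show ?thesis
      by simp
  qed

  show ?thesis
    unfolding vector_absolutely_continuous_def
  proof
    fix N assume N: "N \<in> null_sets torus_haar"
    then have Nb: "N \<in> sets torus_borel"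
      using sets_torus_haar by auto
    have "\<mu> N = complex_measure_integral torus_borel \<mu> (indicator N)"
      using complex_measure_integral_indicator[OF \<mu> Nb] by simp
    also have "\<dots> = (\<integral>z. h z * indicator N z \<partial>S)"
      using Nb by (intro rep[rule_format] exI[of _ 1]) (auto simp: indicator_def)
    also have "\<dots> = (\<integral>z. hE z * indicator N z \<partial>S)"
    proof (rule integral_cong_AE)
      show "AE z in S. h z * indicator N z = hE z * indicator N z"
        using AE_not_in[OF largest[OF N]]
        by eventually_elim (auto simp: hE_def split: split_indicator)
    qed (use ind[OF h Nb] ind[OF hE Nb] in auto)
    also have "\<dots> = 0"
      by (rule integral_zero_of_fourier_coefficients_zero[OF s hE hE_coeff Nb])
    finally show "\<mu> N = 0" .
  qed
qed

end
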